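(* Let $\epsilon>0$. Let $N$ and $Q$ be integers with $N>Q^{2+\epsilon}$, let $a_p$ be complex numbers for every prime $p\leq N$, and let $2\leq R\leq \sqrt{N}$ be an integer. Then \[ \sum_{q\leq Q}\ {\sum_{\chi\pmod{q}}}^{*}\left|\sum_{p\leq N} a_p\chi(p)\right|^2 \ll_\epsilon \frac{N}{\log N}\sum_{p\leq N}|a_p|^2, \] where the implied constant depends only on $\epsilon$.
   Context: Sums over $p$ run over prime numbers. ${\sum_{\chi\pmod q}}^{*}$ denotes summation over primitive Dirichlet characters modulo $q$. *)

theory Defs
  imports "HOL-Analysis.Analysis" "HOL-Number_Theory.Number_Theory"
begin

definition dirichlet_char :: "nat \<Rightarrow> (nat \<Rightarrow> complex) \<Rightarrow> bool" where
  "dirichlet_char q chi \<longleftrightarrow> q > 0 \<and>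
     (\<forall>m n. chi (m * n) = chi m * chi n) \<and>
     (\<forall>n. chi (n + q) = chi n) \<and>
     (\<forall>n. chi n = 0 \<longleftrightarrow> \<not> coprime n q)"

definition primitive_char :: "nat \<Rightarrow> (nat \<Rightarrow> complex) \<Rightarrow> bool" where
  "primitive_char q chi \<longleftrightarrow> dirichlet_char q chi \<and>
     \<not> (\<exists>d. d dvd q \<and> d < q \<and>
           (\<forall>n. coprime n q \<and> [n = 1] (mod d) \<longrightarrow> chi n = 1))"

end

theory Submission
  imports Defs "HOL-Computational_Algebra.Squarefree"
begin

text \<open>
  Split the primes at \<open>\<surd>N\<close>. Primes \<open>p > \<surd>N\<close> are coprime to every modulus \<open>k \<le> \<surd>N\<close>, so
  the Bombieri--Davenport refinement of the large sieve applies: for fixed \<open>k\<close>, the characters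
  induced from primitive \<open>\<chi>\<close> modulo \<open>q\<close> with \<open>k = q r\<close>, \<open>r\<close> squarefree and coprime to \<open>q\<close>, are
  distinct, hence orthogonal, and have Gauss sums of modulus \<open>\<surd>q\<close>. Bessel's inequality together
  with the additive large sieve over the fractions \<open>c / k\<close> gives each \<open>\<chi>\<close> the weight
  \<open>q / \<phi>(q) \<Sum>\<^sub>r 1 / \<phi>(r) \<ge> \<Sum>\<^sub>n 1 / n\<close> with \<open>n, r \<le> \<surd>N / q\<close>, which is at least a constant times
  \<open>log N\<close> because \<open>q \<le> Q < N\<^bsup>1/(2+\<epsilon>)\<^esup>\<close>. The primes \<open>p \<le> \<surd>N\<close> contribute \<open>O(\<surd>N + Q\<^sup>2)\<close> times
  the sum of squares by the classical large sieve, a power of \<open>N\<close> less than required.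
\<close>

subsection \<open>The additive large sieve\<close>

text \<open>A matrix and its transpose have the same operator norm. The dual bound is applied to the
  conjugates of the sums \<open>S i\<close>; Cauchy-Schwarz then gives
  \<open>L * L <= A * (D * L)\<close>, and one factor \<open>L\<close> cancels.\<close>

lemma bilinear_form_duality:
  fixes c :: "'i \<Rightarrow> 'j \<Rightarrow> complex"
  assumes "finite I" "finite J" "D \<ge> 0"
    and dual: "\<And>b. (\<Sum>j\<in>J. (cmod (\<Sum>i\<in>I. b i * c i j))\<^sup>2) \<le> D * (\<Sum>i\<in>I. (cmod (b i))\<^sup>2)"
  shows "(\<Sum>i\<in>I. (cmod (\<Sum>j\<in>J. a j * c i j))\<^sup>2) \<le> D * (\<Sum>j\<in>J. (cmod (a j))\<^sup>2)"
proof -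
  define S where "S i = (\<Sum>j\<in>J. a j * c i j)" for i
  define T where "T j = (\<Sum>i\<in>I. cnj (S i) * c i j)" for j
  define L where "L = (\<Sum>i\<in>I. (cmod (S i))\<^sup>2)"
  define A where "A = (\<Sum>j\<in>J. (cmod (a j))\<^sup>2)"
  have "complex_of_real L = (\<Sum>i\<in>I. cnj (S i) * S i)"
    unfolding L_def of_real_sum complex_norm_square by (simp only: mult.commute)
  also have "\<dots> = (\<Sum>i\<in>I. \<Sum>j\<in>J. a j * (cnj (S i) * c i j))"
    by (subst (2) S_def) (simp add: sum_distrib_left mult_ac)
  also have "\<dots> = (\<Sum>j\<in>J. a j * T j)"
    by (subst sum.swap) (simp add: T_def sum_distrib_left)
  finally have L: "complex_of_real L = (\<Sum>j\<in>J. a j * T j)" .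
  have L0: "L \<ge> 0" unfolding L_def by (simp add: sum_nonneg)
  have A0: "A \<ge> 0" unfolding A_def by (simp add: sum_nonneg)
  have "L = cmod (complex_of_real L)" using L0 by simp
  also have "\<dots> \<le> (\<Sum>j\<in>J. cmod (a j) * cmod (T j))"
    unfolding L by (rule order_trans[OF norm_sum]) (simp add: norm_mult)
  finally have "L\<^sup>2 \<le> (\<Sum>j\<in>J. cmod (a j) * cmod (T j))\<^sup>2"
    using L0 by (intro power_mono) auto
  also have "\<dots> \<le> A * (\<Sum>j\<in>J. (cmod (T j))\<^sup>2)"
    unfolding A_def by (rule Cauchy_Schwarz_ineq_sum)
  also have "\<dots> \<le> A * (D * L)"
    using dual[of "\<lambda>i. cnj (S i)"] A0 unfolding T_def L_def by (intro mult_left_mono) auto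
  finally have "L * L \<le> (D * A) * L" by (simp add: power2_eq_square mult_ac)
  then have "L \<le> D * A" using L0 A0 assms(3) by (cases "L = 0") auto
  then show ?thesis unfolding L_def S_def A_def .
qed

text \<open>The term \<open>1 / real n\<close> makes the induction telescope. Division by zero
  yields 0, so the bound also holds for \<open>n = 0\<close>.\<close>

lemma sum_inverse_squares_le: "(\<Sum>j\<in>{1..n}. 1 / (real j)\<^sup>2) \<le> 2 - 1 / real n"
proof (induction n)
  case (Suc n)
  have "1 / (real (Suc n))\<^sup>2 \<le> 1 / real n - 1 / real (Suc n)" if "n > 0"
    using that by (simp add: divide_simps power2_eq_square)
  with Suc show ?case by (cases "n = 0") auto
qed simp

text \<open>A weak Jordan inequality from the Taylor polynomial: \<open>sin t\<close> is at least
  \<open>t - t^3 / 6\<close>, and \<open>t <= 2\<close> bounds the cubic term by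
  \<open>2 * t / 3\<close>.\<close>

lemma sin_ge_third:
  assumes "0 \<le> t" "t \<le> pi / 2"
  shows "sin t \<ge> t / 3"
proof -
  have "\<bar>sin t - (\<Sum>m<3. sin_coeff m * t ^ m)\<bar> \<le> inverse (fact 3) * \<bar>t\<bar> ^ 3"
    by (rule Maclaurin_sin_bound)
  then have "\<bar>sin t - t\<bar> \<le> t ^ 3 / 6"
    using assms by (simp add: sin_coeff_def eval_nat_numeral field_simps)
  moreover have "t ^ 3 \<le> t * 4"
  proof -
    have "t \<le> 2" using assms pi_less_4 by simp
    then have "t * (t * t) \<le> t * (2 * 2)" using assms by (intro mult_left_mono mult_mono) auto
    then show ?thesis by (simp add: power3_eq_cube)
  qed
  ultimately show ?thesis by linarith
qed

lemma norm_one_minus_cis: "cmod (1 - cis (2 * t)) = 2 * \<bar>sin t\<bar>"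
proof -
  have "(cmod (1 - cis (2 * t)))\<^sup>2 = (1 - cos (2 * t))\<^sup>2 + (sin (2 * t))\<^sup>2"
    by (simp add: cmod_power2)
  also have "\<dots> = 2 - 2 * cos (2 * t)"
    using sin_cos_squared_add[of "2 * t"] by (simp add: power2_diff)
  also have "\<dots> = (2 * \<bar>sin t\<bar>)\<^sup>2"
    by (simp add: cos_double_sin power_mult_distrib)
  finally show ?thesis by (subst (asm) power2_eq_iff_nonneg) auto
qed

text \<open>The chord from 1 is twice a sine; \<open>x\<close> is reflected to \<open>1 - x\<close>
  when it exceeds 1/2. The factor pi > 3 absorbs the 3 lost in \<open>sin_ge_third\<close>.\<close>

lemma norm_one_minus_cis_ge:
  assumes "0 \<le> x" "x \<le> 1"
  shows "cmod (1 - cis (2 * pi * x)) \<ge> 2 * min x (1 - x)"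
proof -
  have *: "2 * y \<le> 2 * sin (pi * y)" if "0 \<le> y" "y \<le> 1 / 2" for y
  proof -
    have "3 * y \<le> pi * y" using that pi_gt3 by (intro mult_right_mono) auto
    moreover have "sin (pi * y) \<ge> pi * y / 3" using that by (intro sin_ge_third) (auto simp: field_simps)
    ultimately show ?thesis by simp
  qed
  have s: "sin (pi * (1 - x)) = sin (pi * x)" by (simp add: algebra_simps sin_diff)
  have "2 * min x (1 - x) \<le> 2 * sin (pi * x)"
    using *[of x] *[of "1 - x"] assms s by (cases "x \<le> 1 / 2") (auto simp: min_def)
  then show ?thesis using norm_one_minus_cis[of "pi * x"] by (simp add: mult_ac)
qed

text \<open>A geometric sum: its numerator has modulus at most 2, its denominator at least twice the
  distance from \<open>x\<close> to the nearest integer.\<close>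

lemma dirichlet_kernel_le:
  fixes M :: nat
  assumes "0 < x" "x < 1"
  shows "cmod (\<Sum>i<M. cis (2 * pi * x * real i)) \<le> 1 / min x (1 - x)"
proof -
  define z where "z = cis (2 * pi * x)"
  have ge: "cmod (1 - z) \<ge> 2 * min x (1 - x)"
    unfolding z_def using assms by (intro norm_one_minus_cis_ge) auto
  have z1: "z \<noteq> 1" using ge assms by (auto simp: min_def split: if_splits)
  have "cis (2 * pi * x * real i) = z ^ i" for i
    unfolding z_def Complex.DeMoivre by (rule arg_cong[where f=cis]) simp
  then have "(\<Sum>i<M. cis (2 * pi * x * real i)) = (\<Sum>i<M. z ^ i)" by simp
  also have "\<dots> = (1 - z ^ M) / (1 - z)" using z1 by (simp add: sum_gp_strict)
  finally have "cmod (\<Sum>i<M. cis (2 * pi * x * real i)) = cmod (1 - z ^ M) / cmod (1 - z)"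
    by (simp add: norm_divide)
  also have "\<dots> \<le> 2 / (2 * min x (1 - x))"
  proof (rule frac_le)
    have "cmod (1 - z ^ M) \<le> cmod 1 + cmod (z ^ M)" by (rule norm_triangle_ineq4)
    then show "cmod (1 - z ^ M) \<le> 2" by (simp add: z_def norm_power)
  qed (use assms ge in auto)
  finally show ?thesis by simp
qed

lemma cis_2pi_frac: "cis (2 * pi * x * real i) = cis (2 * pi * frac x * real i)"
proof -
  have "2 * pi * x * real i = 2 * pi * frac x * real i + 2 * pi * (of_int (\<lfloor>x\<rfloor> * int i))"
    by (simp add: frac_def algebra_simps)
  also have "cis \<dots> = cis (2 * pi * frac x * real i)"
    by (simp add: cis_mult[symmetric] cis_multiple_2pi)
  finally show ?thesis .
qed

lemma inverse_square_le:
  fixes d l y :: real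
  assumes "0 < d" "0 < y" "d \<le> l * y"
  shows "1 / y\<^sup>2 \<le> l\<^sup>2 * (1 / d\<^sup>2)"
proof -
  have "d\<^sup>2 \<le> l\<^sup>2 * y\<^sup>2"
    using power_mono[of d "l * y" 2] assms by (simp add: power_mult_distrib)
  then have "d\<^sup>2 / (d\<^sup>2 * y\<^sup>2) \<le> (l\<^sup>2 * y\<^sup>2) / (d\<^sup>2 * y\<^sup>2)"
    by (rule divide_right_mono) simp
  then show ?thesis using assms by simp
qed

text \<open>
  Sort the points by \<open>J t\<close>, the index of the interval of length \<open>1 / L\<close> containing the fractional
  part of \<open>\<alpha> t - \<beta>\<close>: spacing makes \<open>J\<close> injective. The terms of \<open>h\<close> dividing by zero vanish, and
  there the trivial bound for the kernel takes over.
\<close>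
lemma spaced_kernel_sum_le:
  fixes \<alpha> :: "'s \<Rightarrow> real" and L N :: nat
  assumes fin: "finite S" and L: "0 < L" "L \<le> N"
    and sp: "\<And>s t z. s \<in> S \<Longrightarrow> t \<in> S \<Longrightarrow> s \<noteq> t \<Longrightarrow> \<bar>\<alpha> s - \<alpha> t - of_int z\<bar> \<ge> 1 / real L"
  shows "(\<Sum>t\<in>S. (cmod (\<Sum>i<2*N. cis (2 * pi * (\<alpha> t - \<beta>) * real i)))\<^sup>2) \<le> 12 * (real N)\<^sup>2"
proof -
  define x where "x t = frac (\<alpha> t - \<beta>)" for t
  define J where "J t = nat \<lfloor>real L * x t\<rfloor>" for t
  define h where "h j = (if j = 0 then 4 * (real N)\<^sup>2 else 0) + (if j = L - 1 then 4 * (real N)\<^sup>2 else 0)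
      + (real L)\<^sup>2 * (1 / (real j)\<^sup>2) + (real L)\<^sup>2 * (1 / (real (L - 1 - j))\<^sup>2)" for j
  define D where "D t = cmod (\<Sum>i<2*N. cis (2 * pi * (\<alpha> t - \<beta>) * real i))" for t
  have x01: "0 \<le> x t" "x t < 1" for t by (auto simp: x_def frac_lt_1)
  have J: "real (J t) \<le> real L * x t" "real L * x t < real (J t) + 1" for t
  proof -
    have "\<lfloor>real L * x t\<rfloor> \<ge> 0" using x01[of t] by simp
    then have "real (J t) = of_int \<lfloor>real L * x t\<rfloor>" by (simp add: J_def)
    then show "real (J t) \<le> real L * x t" "real L * x t < real (J t) + 1" by linarith+
  qed
  have JL: "J t < L" for t
  proof -
    have "real L * x t < real L" using x01[of t] L by simp
    then show ?thesis using J(1)[of t] by linarith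
  qed
  have inj: "inj_on J S"
  proof (rule inj_onI, rule ccontr)
    fix s t assume st: "s \<in> S" "t \<in> S" "J s = J t" "s \<noteq> t"
    have "\<bar>real L * x s - real L * x t\<bar> < 1"
      using J[of s] J[of t] st(3) by linarith
    then have "real L * \<bar>x s - x t\<bar> < 1"
      using L by (simp add: abs_mult flip: right_diff_distrib)
    then have "\<bar>x s - x t\<bar> < 1 / real L" using L by (simp add: field_simps)
    moreover have "x s - x t = \<alpha> s - \<alpha> t - of_int (\<lfloor>\<alpha> s - \<beta>\<rfloor> - \<lfloor>\<alpha> t - \<beta>\<rfloor>)"
      by (simp add: x_def frac_def)
    ultimately show False using sp[OF st(1,2,4), of "\<lfloor>\<alpha> s - \<beta>\<rfloor> - \<lfloor>\<alpha> t - \<beta>\<rfloor>"] by linarith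
  qed
  have D: "(D t)\<^sup>2 \<le> h (J t)" for t
  proof (cases "J t = 0 \<or> J t = L - 1")
    case True
    have "D t \<le> (\<Sum>i<2*N. 1)" unfolding D_def by (rule sum_norm_le) simp
    then have "(D t)\<^sup>2 \<le> (2 * real N)\<^sup>2" by (intro power_mono) (auto simp: D_def)
    also have "\<dots> \<le> h (J t)" using True by (auto simp: h_def power2_eq_square)
    finally show ?thesis .
  next
    case False
    have j: "J t > 0" "L - 1 - J t > 0" using False JL[of t] by auto
    have "0 < real L * x t" using J(1)[of t] j by linarith
    then have xp: "0 < x t" using L by (simp add: zero_less_mult_iff)
    have "D t \<le> 1 / min (x t) (1 - x t)"
      unfolding D_def using dirichlet_kernel_le[of "x t" "2*N"] x01[of t] xp
      by (simp add: cis_2pi_frac[of "\<alpha> t - \<beta>"] x_def)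
    then have "(D t)\<^sup>2 \<le> (1 / min (x t) (1 - x t))\<^sup>2" by (intro power_mono) (auto simp: D_def)
    also have "\<dots> \<le> 1 / (x t)\<^sup>2 + 1 / (1 - x t)\<^sup>2"
      by (auto simp: min_def power_divide)
    also have "1 / (x t)\<^sup>2 \<le> (real L)\<^sup>2 * (1 / (real (J t))\<^sup>2)"
      using J(1)[of t] xp j by (intro inverse_square_le) auto
    \<comment> \<open>\<open>L - 1 - J t\<close> is the index counted from the right end; it does
      not exceed \<open>L * (1 - x t)\<close> because \<open>L * x t < J t + 1\<close>.\<close>
    also have "1 / (1 - x t)\<^sup>2 \<le> (real L)\<^sup>2 * (1 / (real (L - 1 - J t))\<^sup>2)"
    proof (rule inverse_square_le)
      have "real (L - 1 - J t) = real L - 1 - real (J t)" using j by linarith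
      then show "real (L - 1 - J t) \<le> real L * (1 - x t)"
        using J(2)[of t] by (simp add: right_diff_distrib)
    qed (use x01[of t] j in auto)
    finally show ?thesis using False by (simp add: h_def)
  qed
  have sq: "(\<Sum>j<L. 1 / (real j)\<^sup>2) \<le> 2"
  proof -
    have "(\<Sum>j<L. 1 / (real j)\<^sup>2) = (\<Sum>j\<in>{1..L-1}. 1 / (real j)\<^sup>2)"
      by (rule sum.mono_neutral_right) (use L in \<open>auto simp: not_le\<close>)
    also have "\<dots> \<le> 2 - 1 / real (L - 1)" by (rule sum_inverse_squares_le)
    finally show ?thesis using of_nat_0_le_iff[of "L - 1", where 'a=real]
      by (smt (verit) divide_nonneg_nonneg)
  qed
  have rev: "(\<Sum>j<L. 1 / (real (L - 1 - j))\<^sup>2) = (\<Sum>j<L. 1 / (real j)\<^sup>2)"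
    using sum.nat_diff_reindex[of "\<lambda>j. 1 / (real j)\<^sup>2" L] by simp
  have h0: "h j \<ge> 0" for j by (simp add: h_def)
  have "(\<Sum>t\<in>S. (D t)\<^sup>2) \<le> (\<Sum>t\<in>S. h (J t))" by (intro sum_mono D)
  also have "\<dots> = (\<Sum>j\<in>J`S. h j)" using inj by (simp add: sum.reindex)
  also have "\<dots> \<le> (\<Sum>j<L. h j)" using JL h0 by (intro sum_mono2) auto
  \<comment> \<open>The two end intervals cost \<open>4 * N^2\<close> each, and the two
    inverse-square sums at most \<open>2 * L^2\<close> each. With \<open>L <= N\<close> this is the
    constant 12.\<close>
  also have "\<dots> = 8 * (real N)\<^sup>2 + (real L)\<^sup>2 * (2 * (\<Sum>j<L. 1 / (real j)\<^sup>2))"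
    using L unfolding h_def sum.distrib sum_distrib_left[symmetric] rev by simp
  also have "\<dots> \<le> 8 * (real N)\<^sup>2 + (real N)\<^sup>2 * (2 * 2)"
    using L sq by (intro add_left_mono mult_mono power_mono) (auto intro: sum_nonneg)
  finally show ?thesis by (simp add: D_def)
qed

lemma sum_swap_pairs:
  fixes f :: "'a \<Rightarrow> 'b \<Rightarrow> 'c \<Rightarrow> 'd \<Rightarrow> 'e::comm_monoid_add"
  shows "(\<Sum>i\<in>A. \<Sum>j\<in>B. \<Sum>s\<in>C. \<Sum>t\<in>D. f i j s t) = (\<Sum>s\<in>C. \<Sum>t\<in>D. \<Sum>i\<in>A. \<Sum>j\<in>B. f i j s t)"
proof -
  have *: "(\<Sum>i\<in>A. \<Sum>j\<in>B. \<Sum>s\<in>X. g i j s) = (\<Sum>s\<in>X. \<Sum>i\<in>A. \<Sum>j\<in>B. g i j s)"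
    for X :: "'x set" and g :: "'a \<Rightarrow> 'b \<Rightarrow> 'x \<Rightarrow> 'e"
    by (subst sum.swap[where A=X]) (intro sum.cong refl sum.swap)
  show ?thesis by (simp only: *)
qed

text \<open>
  Each difference \<open>n \<in> {1..N}\<close> of two numbers below \<open>2 N\<close> occurs at least \<open>N\<close> times; replacing
  the sum over \<open>n\<close> by the sum over all pairs makes the kernel a nonnegative square (a Fejer kernel).
\<close>
lemma large_sieve_dual:
  fixes \<alpha> :: "'s \<Rightarrow> real" and L N :: nat
  assumes fin: "finite S" and L: "0 < L" "L \<le> N"
    and sp: "\<And>s t z. s \<in> S \<Longrightarrow> t \<in> S \<Longrightarrow> s \<noteq> t \<Longrightarrow> \<bar>\<alpha> s - \<alpha> t - of_int z\<bar> \<ge> 1 / real L"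
  shows "(\<Sum>n\<in>{1..N}. (cmod (\<Sum>s\<in>S. b s * cis (2 * pi * \<alpha> s * real n)))\<^sup>2)
           \<le> 12 * real N * (\<Sum>s\<in>S. (cmod (b s))\<^sup>2)"
proof -
  define T where "T y = (\<Sum>s\<in>S. b s * cis (2 * pi * \<alpha> s * y))" for y :: real
  define K where "K s t = (cmod (\<Sum>i<2*N. cis (2 * pi * (\<alpha> s - \<alpha> t) * real i)))\<^sup>2" for s t
  have Ksym: "K s t = K t s" for s t
  proof -
    have "(\<Sum>i<2*N. cis (2 * pi * (\<alpha> s - \<alpha> t) * real i)) = cnj (\<Sum>i<2*N. cis (2 * pi * (\<alpha> t - \<alpha> s) * real i))"
      unfolding cnj_sum cis_cnj by (rule sum.cong) (auto simp: algebra_simps)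
    then show ?thesis unfolding K_def by (metis complex_mod_cnj)
  qed

  define E where "E = (\<Sum>i<2*N. \<Sum>j<2*N. (cmod (T (real i - real j)))\<^sup>2)"
  define B where "B = (\<Sum>s\<in>S. (cmod (b s))\<^sup>2)"
  have "real N * (\<Sum>n\<in>{1..N}. (cmod (T (real n)))\<^sup>2)
      = (\<Sum>(n,j)\<in>{1..N}\<times>{..<N}. (cmod (T (real n)))\<^sup>2)"
    by (simp add: sum.cartesian_product[symmetric] sum_distrib_left)
  also have "\<dots> = (\<Sum>(i,j)\<in>(\<lambda>(n,j). (n+j,j)) ` ({1..N}\<times>{..<N}). (cmod (T (real i - real j)))\<^sup>2)"
    by (subst sum.reindex) (auto simp: inj_on_def case_prod_unfold)
  also have "\<dots> \<le> (\<Sum>(i,j)\<in>{..<2*N}\<times>{..<2*N}. (cmod (T (real i - real j)))\<^sup>2)"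
    by (rule sum_mono2) auto
  also have "\<dots> = E" by (simp add: E_def sum.cartesian_product)
  finally have NE: "real N * (\<Sum>n\<in>{1..N}. (cmod (T (real n)))\<^sup>2) \<le> E" .
  have "complex_of_real E = (\<Sum>i<2*N. \<Sum>j<2*N. T (real i - real j) * cnj (T (real i - real j)))"
    by (simp only: E_def complex_norm_square of_real_sum)
  also have "\<dots> = (\<Sum>i<2*N. \<Sum>j<2*N. \<Sum>s\<in>S. \<Sum>t\<in>S. b s * cnj (b t) *
       (cis (2 * pi * (\<alpha> s - \<alpha> t) * real i) * cnj (cis (2 * pi * (\<alpha> s - \<alpha> t) * real j))))"
  proof (intro sum.cong refl)
    fix i j
    have *: "cis (2 * pi * \<alpha> s * (real i - real j)) * cnj (cis (2 * pi * \<alpha> t * (real i - real j)))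
      = cis (2 * pi * (\<alpha> s - \<alpha> t) * real i) * cnj (cis (2 * pi * (\<alpha> s - \<alpha> t) * real j))" for s t
      unfolding cis_cnj cis_mult by (simp add: algebra_simps)
    show "T (real i - real j) * cnj (T (real i - real j)) = (\<Sum>s\<in>S. \<Sum>t\<in>S. b s * cnj (b t) *
       (cis (2 * pi * (\<alpha> s - \<alpha> t) * real i) * cnj (cis (2 * pi * (\<alpha> s - \<alpha> t) * real j))))"
      unfolding T_def cnj_sum sum_product *[symmetric]
      by (intro sum.cong refl) (simp only: complex_cnj_mult mult_ac)
  qed
  also have "\<dots> = (\<Sum>s\<in>S. \<Sum>t\<in>S. \<Sum>i<2*N. \<Sum>j<2*N. b s * cnj (b t) *
      (cis (2 * pi * (\<alpha> s - \<alpha> t) * real i) * cnj (cis (2 * pi * (\<alpha> s - \<alpha> t) * real j))))"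
    by (rule sum_swap_pairs)
  also have "\<dots> = (\<Sum>s\<in>S. \<Sum>t\<in>S. b s * cnj (b t) * complex_of_real (K s t))"
    unfolding K_def complex_norm_square cnj_sum sum_product by (simp only: sum_distrib_left)
  finally have E: "complex_of_real E = \<dots>" .
  have K0: "K s t \<ge> 0" for s t by (simp add: K_def)
  have "E \<ge> 0" by (simp add: E_def sum_nonneg)
  then have "E = cmod (complex_of_real E)" by simp
  also have "\<dots> \<le> (\<Sum>s\<in>S. \<Sum>t\<in>S. cmod (b s) * cmod (b t) * K s t)"
    unfolding E by (intro sum_norm_le) (simp add: norm_mult K0)
  \<comment> \<open>Schur's test: the arithmetic-geometric mean inequality and the symmetry of
    \<open>K\<close> reduce the quadratic form to row sums of \<open>K\<close>, which
    \<open>spaced_kernel_sum_le\<close> bounds with \<open>\<beta> = \<alpha> s\<close>.\<close>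
  also have "\<dots> \<le> (\<Sum>s\<in>S. \<Sum>t\<in>S. (cmod (b s))\<^sup>2 * K s t / 2 + (cmod (b t))\<^sup>2 * K s t / 2)"
  proof (intro sum_mono)
    fix s t
    have "cmod (b s) * cmod (b t) \<le> ((cmod (b s))\<^sup>2 + (cmod (b t))\<^sup>2) / 2"
      using sum_squares_bound[of "cmod (b s)" "cmod (b t)"] by simp
    from mult_right_mono[OF this K0[of s t]]
    show "cmod (b s) * cmod (b t) * K s t \<le> (cmod (b s))\<^sup>2 * K s t / 2 + (cmod (b t))\<^sup>2 * K s t / 2"
      by (simp add: algebra_simps add_divide_distrib)
  qed
  also have "\<dots> = (\<Sum>s\<in>S. (cmod (b s))\<^sup>2 * (\<Sum>t\<in>S. K t s)) / 2 + (\<Sum>s\<in>S. \<Sum>t\<in>S. (cmod (b t))\<^sup>2 * K s t) / 2"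
    by (simp add: sum.distrib sum_distrib_left sum_divide_distrib Ksym)
  also have "(\<Sum>s\<in>S. \<Sum>t\<in>S. (cmod (b t))\<^sup>2 * K s t) = (\<Sum>s\<in>S. (cmod (b s))\<^sup>2 * (\<Sum>t\<in>S. K t s))"
    by (subst sum.swap) (simp add: sum_distrib_left)
  also have "(\<Sum>s\<in>S. (cmod (b s))\<^sup>2 * (\<Sum>t\<in>S. K t s)) / 2 + \<dots> / 2 = (\<Sum>s\<in>S. (cmod (b s))\<^sup>2 * (\<Sum>t\<in>S. K t s))"
    by simp
  also have "\<dots> \<le> (\<Sum>s\<in>S. (cmod (b s))\<^sup>2 * (12 * (real N)\<^sup>2))"
    unfolding K_def by (intro sum_mono mult_left_mono spaced_kernel_sum_le[OF fin L sp]) auto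
  also have "\<dots> = real N * (12 * real N * B)"
    unfolding B_def sum_distrib_right[symmetric] by (simp add: power2_eq_square)
  finally have "real N * (\<Sum>n\<in>{1..N}. (cmod (T (real n)))\<^sup>2) \<le> real N * (12 * real N * B)"
    using NE by linarith
  then show ?thesis using L unfolding T_def B_def by simp
qed

text \<open>Duality exchanges the roles of points and integers in the preceding bound.\<close>

lemma large_sieve_points:
  fixes \<alpha> :: "'s \<Rightarrow> real" and L N :: nat
  assumes fin: "finite S" and L: "0 < L" "L \<le> N"
    and sp: "\<And>s t z. s \<in> S \<Longrightarrow> t \<in> S \<Longrightarrow> s \<noteq> t \<Longrightarrow> \<bar>\<alpha> s - \<alpha> t - of_int z\<bar> \<ge> 1 / real L"
  shows "(\<Sum>s\<in>S. (cmod (\<Sum>n\<in>{1..N}. a n * cis (2 * pi * \<alpha> s * real n)))\<^sup>2)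
           \<le> 12 * real N * (\<Sum>n\<in>{1..N}. (cmod (a n))\<^sup>2)"
  by (rule bilinear_form_duality[OF fin]) (use large_sieve_dual[OF fin L sp] in auto)

subsection \<open>Dirichlet characters and Gauss sums\<close>

definition add_char :: "nat \<Rightarrow> nat \<Rightarrow> complex" where
  "add_char k m = cis (2 * pi * real m / real k)"

definition periodic_mod :: "nat \<Rightarrow> (nat \<Rightarrow> 'a) \<Rightarrow> bool" where
  "periodic_mod k f \<longleftrightarrow> (\<forall>m n. [m = n] (mod k) \<longrightarrow> f m = f n)"

lemma periodic_modD: "periodic_mod k f \<Longrightarrow> [m = n] (mod k) \<Longrightarrow> f m = f n"
  by (auto simp: periodic_mod_def)

lemma periodic_mod_step:
  assumes "\<And>n. f (n + k) = f n"
  shows "periodic_mod k f"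
proof -
  have *: "f (n + j * k) = f n" for n j
    using assms by (induction j) (simp_all add: add.assoc[symmetric] add.commute[of k])
  have "f n = f (n mod k)" for n
    using *[of "n mod k" "n div k"] by simp
  then show ?thesis unfolding periodic_mod_def cong_def by metis
qed

lemma periodic_mod_coprime: "periodic_mod k (\<lambda>c. of_bool (coprime c k) :: 'a::zero_neq_one)"
proof -
  have "coprime m k \<longleftrightarrow> coprime n k" if "[m = n] (mod k)" for m n
    using that cong_imp_coprime cong_sym by blast
  then show ?thesis unfolding periodic_mod_def by simp
qed

lemma periodic_mod_mult:
  "periodic_mod k f \<Longrightarrow> periodic_mod k g \<Longrightarrow> periodic_mod k (\<lambda>c. f c * g c)"
  unfolding periodic_mod_def by metis

lemma periodic_mod_scale: "periodic_mod k f \<Longrightarrow> periodic_mod k (\<lambda>c. f (c * m))"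
  unfolding periodic_mod_def using cong_scalar_right by blast

lemma periodic_add_char: "k > 0 \<Longrightarrow> periodic_mod k (add_char k)"
proof (rule periodic_mod_step)
  fix n assume "k > 0"
  then have "2 * pi * real (n + k) / real k = 2 * pi * real n / real k + 2 * pi * 1"
    by (simp add: field_simps)
  then show "add_char k (n + k) = add_char k n"
    unfolding add_char_def by (simp only: cis_mult[symmetric]) simp
qed

lemma add_char_add: "add_char k (m + n) = add_char k m * add_char k n"
  by (simp add: add_char_def cis_mult add_divide_distrib algebra_simps)

lemma add_char_mult_cancel: "r > 0 \<Longrightarrow> add_char (k * r) (m * r) = add_char k m"
  unfolding add_char_def by (rule arg_cong[where f=cis]) (simp add: field_simps)

text \<open>Multiplication by a unit permutes the residues modulo \<open>k\<close>.\<close>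

lemma sum_mod_mult:
  fixes f :: "nat \<Rightarrow> 'a::comm_monoid_add"
  assumes "periodic_mod k f" "coprime m k"
  shows "(\<Sum>c<k. f (c * m)) = (\<Sum>c<k. f c)"
proof -
  have inj: "inj_on (\<lambda>c. c * m mod k) {..<k}"
  proof (rule inj_onI)
    fix x y assume "x \<in> {..<k}" "y \<in> {..<k}" "x * m mod k = y * m mod k"
    then have "[x = y] (mod k)"
      using cong_mult_rcancel_nat[of m k x y] assms(2) by (simp add: cong_def)
    then show "x = y" using \<open>x \<in> {..<k}\<close> \<open>y \<in> {..<k}\<close> by (simp add: cong_less_modulus_unique_nat)
  qed
  have "(\<lambda>c. c * m mod k) ` {..<k} = {..<k}"
    by (rule endo_inj_surj[OF _ _ inj]) auto
  then have "(\<Sum>c<k. f c) = (\<Sum>c\<in>(\<lambda>c. c * m mod k) ` {..<k}. f c)" by simp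
  also have "\<dots> = (\<Sum>c<k. f (c * m mod k))" using inj by (simp add: sum.reindex)
  also have "\<dots> = (\<Sum>c<k. f (c * m))"
    by (intro sum.cong refl periodic_modD[OF assms(1)]) (simp add: cong_def)
  finally show ?thesis by simp
qed

text \<open>Chinese remainder theorem: reduction modulo \<open>q\<close> and modulo \<open>r\<close>
  recovers \<open>a\<close> and \<open>b\<close>, and counting gives surjectivity. The
  parametrisation \<open>a * r + b * q\<close> is chosen because division by \<open>q * r\<close>
  turns it into \<open>a / q + b / r\<close>, which splits additive characters.\<close>

lemma sum_mod_crt:
  fixes f :: "nat \<Rightarrow> 'a::comm_monoid_add"
  assumes "periodic_mod (q * r) f" "coprime q r" "q > 0" "r > 0"
  shows "(\<Sum>c<q*r. f c) = (\<Sum>a<q. \<Sum>b<r. f (a * r + b * q))"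
proof -
  define h where "h = (\<lambda>(a, b). (a * r + b * q) mod (q * r))"
  have inj: "inj_on h ({..<q} \<times> {..<r})"
  proof -
    have "a = a' \<and> b = b'"
      if ab: "a < q" "b < r" "a' < q" "b' < r" "h (a, b) = h (a', b')" for a b a' b'
    proof -
      from ab have c: "[a * r + b * q = a' * r + b' * q] (mod (q * r))" by (simp add: h_def cong_def)
      have "[a * r = a' * r] (mod q)"
        using cong_modulus_mult_nat[OF c] by (simp add: cong_def)
      then have "[a = a'] (mod q)" using assms(2) by (simp add: cong_mult_rcancel_nat coprime_commute)
      moreover have "[b * q = b' * q] (mod r)"
        using cong_modulus_mult_nat[OF c[unfolded mult.commute[of q r]]] by (simp add: cong_def)
      then have "[b = b'] (mod r)" using assms(2) by (simp add: cong_mult_rcancel_nat)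
      ultimately show ?thesis using ab by (simp add: cong_less_modulus_unique_nat)
    qed
    then show ?thesis by (auto simp: inj_on_def)
  qed
  have "h ` ({..<q} \<times> {..<r}) = {..<q*r}"
  proof (rule card_subset_eq)
    show "h ` ({..<q} \<times> {..<r}) \<subseteq> {..<q*r}" using assms by (auto simp: h_def)
    show "card (h ` ({..<q} \<times> {..<r})) = card {..<q*r}" using inj by (simp add: card_image)
  qed simp
  then have "(\<Sum>c<q*r. f c) = (\<Sum>c\<in>h ` ({..<q} \<times> {..<r}). f c)" by simp
  also have "\<dots> = (\<Sum>x\<in>{..<q} \<times> {..<r}. f (h x))" using inj by (simp add: sum.reindex)
  also have "\<dots> = (\<Sum>(a,b)\<in>{..<q} \<times> {..<r}. f (a * r + b * q))"
    unfolding h_def by (intro sum.cong refl) (auto intro!: periodic_modD[OF assms(1)] simp: cong_def)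
  finally show ?thesis by (simp add: sum.cartesian_product)
qed

text \<open>On the unit circle \<open>cnj z\<close> is the inverse of \<open>z\<close>. This turns a
  trivial quotient of two characters, additive or multiplicative, into equality.\<close>

lemma unit_cnj_cancel:
  assumes "w * cnj z = 1" "z * cnj z = 1"
  shows "w = z"
proof -
  have "(w - z) * cnj z = 0" using assms by (simp add: left_diff_distrib)
  moreover have "cnj z \<noteq> 0" using assms by auto
  ultimately show ?thesis by simp
qed

text \<open>The summands are powers of a \<open>k\<close>-th root of unity \<open>z\<close>, so the
  geometric sum vanishes unless \<open>z = 1\<close>; the \<open>k\<close>-th roots of unity being
  distinct, that means \<open>a = b\<close>.\<close>

lemma add_char_orthogonal:
  assumes "a < k" "b < k"
  shows "(\<Sum>n<k. add_char k (a * n) * cnj (add_char k (b * n))) = (if a = b then of_nat k else 0)"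
proof -
  define z where "z = add_char k a * cnj (add_char k b)"
  have k: "k > 0" using assms by simp
  have pow: "add_char k (m * n) = add_char k m ^ n" for m n
    unfolding add_char_def Complex.DeMoivre by (rule arg_cong[where f=cis]) simp
  have sum: "(\<Sum>n<k. add_char k (a * n) * cnj (add_char k (b * n))) = (\<Sum>n<k. z ^ n)"
    by (simp add: pow z_def power_mult_distrib)
  have one: "add_char k m * cnj (add_char k m) = 1" for m
    by (simp add: add_char_def cis_cnj cis_mult)
  have pk: "add_char k m ^ k = 1" for m
    using k by (simp add: add_char_def Complex.DeMoivre cis_multiple_2pi)
  have "cnj (add_char k b) ^ k = cnj (add_char k b ^ k)" by simp
  also have "\<dots> = 1" by (simp only: pk complex_cnj_one)
  finally have zk: "z ^ k = 1"
    by (simp add: z_def power_mult_distrib pk)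
  have "z = 1 \<longleftrightarrow> a = b"
  proof
    assume "z = 1"
    then have "add_char k a = add_char k b"
      using one[of b] unfolding z_def by (rule unit_cnj_cancel)
    moreover have "inj_on (add_char k) {..<k}"
      using Complex.bij_betw_roots_unity[OF k] unfolding bij_betw_def add_char_def[abs_def] by simp
    ultimately show "a = b" using assms by (auto dest: inj_onD)
  qed (simp add: z_def one)
  then show ?thesis unfolding sum using sum_gp_strict[of z k] zk by auto
qed

lemma parseval_mod:
  "(\<Sum>n<k. (cmod (\<Sum>a<k. f a * add_char k (a * n)))\<^sup>2) = real k * (\<Sum>a<k. (cmod (f a))\<^sup>2)"
proof -
  have "complex_of_real (\<Sum>n<k. (cmod (\<Sum>a<k. f a * add_char k (a * n)))\<^sup>2)
    = (\<Sum>n<k. \<Sum>a<k. \<Sum>b<k. f a * cnj (f b) * (add_char k (a * n) * cnj (add_char k (b * n))))"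
    unfolding of_real_sum complex_norm_square cnj_sum sum_product
    by (intro sum.cong refl) (simp only: complex_cnj_mult mult_ac)
  also have "\<dots> = (\<Sum>a<k. \<Sum>b<k. \<Sum>n<k. f a * cnj (f b) * (add_char k (a * n) * cnj (add_char k (b * n))))"
    by (subst sum.swap) (intro sum.cong refl sum.swap)
  also have "\<dots> = (\<Sum>a<k. \<Sum>b<k. f a * cnj (f b) * (if a = b then of_nat k else 0))"
    by (intro sum.cong refl) (simp add: sum_distrib_left[symmetric] add_char_orthogonal)
  also have "\<dots> = (\<Sum>a<k. of_nat k * (f a * cnj (f a)))"
    by (intro sum.cong refl) (simp add: if_distrib[where f="\<lambda>x. _ * x"] sum.delta mult_ac cong: if_cong)
  also have "\<dots> = complex_of_real (real k * (\<Sum>a<k. (cmod (f a))\<^sup>2))"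
    unfolding of_real_mult of_real_sum complex_norm_square sum_distrib_left by simp
  finally show ?thesis by (simp only: of_real_eq_iff)
qed

section \<open>Dirichlet characters and their orthogonality\<close>

lemma dirichlet_char_periodic: "dirichlet_char k chi \<Longrightarrow> periodic_mod k chi"
  by (rule periodic_mod_step) (auto simp: dirichlet_char_def)

lemma dirichlet_char_mult: "dirichlet_char k chi \<Longrightarrow> chi (m * n) = chi m * chi n"
  by (auto simp: dirichlet_char_def)

lemma dirichlet_char_zero_iff: "dirichlet_char k chi \<Longrightarrow> chi n = 0 \<longleftrightarrow> \<not> coprime n k"
  by (auto simp: dirichlet_char_def)

lemma dirichlet_char_pos: "dirichlet_char k chi \<Longrightarrow> k > 0"
  by (auto simp: dirichlet_char_def)

lemma dirichlet_char_one: 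
  assumes "dirichlet_char k chi"
  shows "chi 1 = 1"
proof -
  have "chi 1 * chi 1 = chi 1" using dirichlet_char_mult[OF assms, of 1 1] by simp
  moreover have "chi 1 \<noteq> 0" using dirichlet_char_zero_iff[OF assms, of 1] by simp
  ultimately show ?thesis by simp
qed

text \<open>By Euler's theorem a nonzero value is a root of unity.\<close>

lemma norm_dirichlet_char:
  assumes chi: "dirichlet_char k chi"
  shows "cmod (chi n) = of_bool (coprime n k)"
proof (cases "coprime n k")
  case True
  have pow: "chi (n ^ j) = chi n ^ j" for j
    by (induction j) (use dirichlet_char_one[OF chi] dirichlet_char_mult[OF chi] in simp_all)
  have "chi n ^ totient k = 1"
    using periodic_modD[OF dirichlet_char_periodic[OF chi] euler_theorem[OF True]]
    by (simp add: pow dirichlet_char_one[OF chi, simplified])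
  from power_eq_1_iff[OF this] show ?thesis
    using True dirichlet_char_pos[OF chi] by auto
qed (use dirichlet_char_zero_iff[OF chi] in simp)

lemma dirichlet_char_mult_cnj:
  "dirichlet_char k chi \<Longrightarrow> chi n * cnj (chi n) = of_bool (coprime n k)"
  by (simp add: complex_norm_square[symmetric] norm_dirichlet_char)

text \<open>Substituting \<open>c * n\<close> for \<open>c\<close>, with \<open>n\<close> a unit at
  which the characters differ, leaves the sum unchanged but multiplies it by a number other than
  1.\<close>

lemma dirichlet_char_orthogonal:
  assumes chi: "dirichlet_char k chi" and psi: "dirichlet_char k psi" and ne: "chi \<noteq> psi"
  shows "(\<Sum>c<k. chi c * cnj (psi c)) = 0"
proof -
  obtain n where n: "chi n \<noteq> psi n" using ne by auto
  then have cop: "coprime n k" using dirichlet_char_zero_iff[OF chi, of n] dirichlet_char_zero_iff[OF psi, of n] by auto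
  let ?S = "\<Sum>c<k. chi c * cnj (psi c)"
  have per: "periodic_mod k (\<lambda>c. chi c * cnj (psi c))"
    using dirichlet_char_periodic[OF chi] dirichlet_char_periodic[OF psi]
    unfolding periodic_mod_def by metis
  have "?S = (\<Sum>c<k. chi (c * n) * cnj (psi (c * n)))"
    using sum_mod_mult[OF per cop] by simp
  also have "\<dots> = (chi n * cnj (psi n)) * ?S"
    by (simp add: dirichlet_char_mult[OF chi] dirichlet_char_mult[OF psi] sum_distrib_left mult_ac)
  finally have "(1 - chi n * cnj (psi n)) * ?S = 0" by (simp add: algebra_simps)
  moreover have "chi n * cnj (psi n) \<noteq> 1"
  proof
    assume "chi n * cnj (psi n) = 1"
    moreover have "psi n * cnj (psi n) = 1" using dirichlet_char_mult_cnj[OF psi, of n] cop by simp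
    ultimately have "chi n = psi n" by (rule unit_cnj_cancel)
    with n show False ..
  qed
  ultimately show ?thesis by simp
qed

text \<open>\<open>totatives k\<close> lies in \<open>{1..k}\<close> instead of
  \<open>{0..<k}\<close>. The two sets of units differ only for \<open>k = 1\<close>, where both
  have one element.\<close>

lemma card_coprime_less: "k > 0 \<Longrightarrow> card {c. c < k \<and> coprime c k} = totient k"
proof (cases "k = 1")
  case False
  assume "k > 0"
  have "{c. c < k \<and> coprime c k} = totatives k"
    using False \<open>k > 0\<close> totatives_less[of _ k] by (auto simp: in_totatives_iff intro!: Nat.gr0I)
  then show ?thesis by (simp add: totient_def)
next
  case True
  then have "{c. c < k \<and> coprime c k} = {0}" by auto
  then show ?thesis using True by simp
qed

text \<open>Distinct characters are orthogonal on the units with squared norm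
  \<open>totient k\<close>, so the dual inequality is an equality.\<close>

lemma dirichlet_char_bessel:
  fixes \<psi> :: "'i \<Rightarrow> nat \<Rightarrow> complex"
  assumes "k > 0" "finite I" "inj_on \<psi> I" and char: "\<And>i. i \<in> I \<Longrightarrow> dirichlet_char k (\<psi> i)"
  shows "(\<Sum>i\<in>I. (cmod (\<Sum>c | c < k \<and> coprime c k. F c * \<psi> i c))\<^sup>2)
      \<le> real (totient k) * (\<Sum>c | c < k \<and> coprime c k. (cmod (F c))\<^sup>2)"
proof (rule bilinear_form_duality)
  let ?U = "{c. c < k \<and> coprime c k}"
  fix b :: "'i \<Rightarrow> complex"
  have sumU: "(\<Sum>c\<in>?U. \<psi> i c * cnj (\<psi> j c)) = (if i = j then of_nat (totient k) else 0)"
    if ij: "i \<in> I" "j \<in> I" for i j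
  proof (cases "i = j")
    case True
    then show ?thesis using dirichlet_char_mult_cnj[OF char[OF ij(1)]] assms(1)
      by (simp add: card_coprime_less)
  next
    case False
    then have "\<psi> i \<noteq> \<psi> j" using assms(3) ij by (auto dest: inj_onD)
    then have "(\<Sum>c<k. \<psi> i c * cnj (\<psi> j c)) = 0"
      by (rule dirichlet_char_orthogonal[OF char[OF ij(1)] char[OF ij(2)]])
    also have "(\<Sum>c<k. \<psi> i c * cnj (\<psi> j c)) = (\<Sum>c\<in>?U. \<psi> i c * cnj (\<psi> j c))"
      by (rule sum.mono_neutral_right) (use dirichlet_char_zero_iff[OF char[OF ij(1)]] in auto)
    finally show ?thesis using False by simp
  qed
  have "complex_of_real (\<Sum>c\<in>?U. (cmod (\<Sum>i\<in>I. b i * \<psi> i c))\<^sup>2)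
    = (\<Sum>c\<in>?U. \<Sum>i\<in>I. \<Sum>j\<in>I. b i * cnj (b j) * (\<psi> i c * cnj (\<psi> j c)))"
    unfolding of_real_sum complex_norm_square cnj_sum sum_product
    by (intro sum.cong refl) (simp only: complex_cnj_mult mult_ac)
  also have "\<dots> = (\<Sum>i\<in>I. \<Sum>j\<in>I. \<Sum>c\<in>?U. b i * cnj (b j) * (\<psi> i c * cnj (\<psi> j c)))"
    by (subst sum.swap) (intro sum.cong refl sum.swap)
  also have "\<dots> = (\<Sum>i\<in>I. \<Sum>j\<in>I. b i * cnj (b j) * (if i = j then of_nat (totient k) else 0))"
    by (intro sum.cong refl) (simp only: sum_distrib_left[symmetric] sumU)
  also have "\<dots> = (\<Sum>i\<in>I. of_nat (totient k) * (b i * cnj (b i)))"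
    using assms(2) by (intro sum.cong refl) (simp add: if_distrib[where f="\<lambda>x. _ * x"] sum.delta mult_ac cong: if_cong)
  also have "\<dots> = complex_of_real (real (totient k) * (\<Sum>i\<in>I. (cmod (b i))\<^sup>2))"
    unfolding of_real_mult of_real_sum complex_norm_square sum_distrib_left by simp
  finally have "(\<Sum>c\<in>?U. (cmod (\<Sum>i\<in>I. b i * \<psi> i c))\<^sup>2) = real (totient k) * (\<Sum>i\<in>I. (cmod (b i))\<^sup>2)"
    by (simp only: of_real_eq_iff)
  then show "(\<Sum>c\<in>?U. (cmod (\<Sum>i\<in>I. b i * \<psi> i c))\<^sup>2) \<le> real (totient k) * (\<Sum>i\<in>I. (cmod (b i))\<^sup>2)"
    by simp
qed (use assms in auto)

section \<open>Gauss sums and Ramanujan sums\<close>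

definition gauss_sum :: "nat \<Rightarrow> (nat \<Rightarrow> complex) \<Rightarrow> nat \<Rightarrow> complex" where
  "gauss_sum k f n = (\<Sum>c<k. f c * add_char k (c * n))"

lemma periodic_gauss_summand:
  "k > 0 \<Longrightarrow> periodic_mod k f \<Longrightarrow> periodic_mod k (\<lambda>c. f c * add_char k (c * n))"
  by (intro periodic_mod_mult periodic_mod_scale periodic_add_char)

lemma gauss_sum_twist:
  assumes chi: "dirichlet_char k chi" and "coprime m k"
  shows "chi m * gauss_sum k chi (m * n) = gauss_sum k chi n"
proof -
  have "gauss_sum k chi n = (\<Sum>c<k. chi (c * m) * add_char k (c * m * n))"
    unfolding gauss_sum_def using dirichlet_char_pos[OF chi] dirichlet_char_periodic[OF chi] assms(2)
    by (intro sum_mod_mult[symmetric] periodic_gauss_summand)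
  also have "\<dots> = chi m * gauss_sum k chi (m * n)"
    by (simp add: gauss_sum_def dirichlet_char_mult[OF chi] sum_distrib_left mult_ac)
  finally show ?thesis by simp
qed

lemma primitive_charD: "primitive_char q chi \<Longrightarrow> dirichlet_char q chi"
  by (simp add: primitive_char_def)

lemma gauss_sum_cong: 
  assumes "k > 0" "[m = n] (mod k)" shows "gauss_sum k f m = gauss_sum k f n"
proof -
  have "add_char k (c * m) = add_char k (c * n)" for c
    using periodic_modD[OF periodic_add_char[OF assms(1)] cong_scalar_left[OF assms(2)]] .
  then show ?thesis by (simp add: gauss_sum_def)
qed

text \<open>With \<open>g = gcd n q\<close>, primitivity supplies a unit \<open>m\<close> that is 1
  modulo \<open>q div g\<close> and has \<open>chi m \<noteq> 1\<close>. Then \<open>m * n\<close>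
  and \<open>n\<close> agree modulo \<open>q\<close>, so twisting by \<open>m\<close> leaves the
  Gauss sum fixed and also rescales it by a factor other than 1.\<close>

lemma gauss_sum_not_coprime:
  assumes prim: "primitive_char q chi" and "\<not> coprime n q"
  shows "gauss_sum q chi n = 0"
proof -
  note chi = primitive_charD[OF prim]
  have q: "q > 0" using dirichlet_char_pos[OF chi] .
  define g where "g = gcd n q"
  have g: "g dvd q" "g dvd n" by (simp_all add: g_def)
  have "g \<noteq> 0" "g \<noteq> 1" using assms(2) q coprime_iff_gcd_eq_1[of n q] by (simp_all only: g_def gcd_eq_0_iff) auto
  then have "g > 1" by simp
  have "q div g dvd q" using g(1) by (metis dvd_div_mult_self dvd_triv_left)
  moreover have "q div g < q" using \<open>g > 1\<close> q by simp
  ultimately obtain m where m: "coprime m q" "[m = 1] (mod (q div g))" "chi m \<noteq> 1"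
    using prim unfolding primitive_char_def by meson
  have "[g * m = g * 1] (mod (g * (q div g)))"
    using m(2) by (simp add: cong_def mult_mod_right[symmetric])
  then have "[g * m * (n div g) = g * 1 * (n div g)] (mod q)"
    using g by (intro cong_scalar_right) simp
  moreover have "g * m * (n div g) = m * n" "g * 1 * (n div g) = n"
    using dvd_mult_div_cancel[OF g(2)] by (simp_all add: mult.commute[of g m] mult.assoc)
  ultimately have "[m * n = n] (mod q)" by simp
  then have "gauss_sum q chi (m * n) = gauss_sum q chi n" using q by (rule gauss_sum_cong[rotated])
  with gauss_sum_twist[OF chi m(1), of n] have "(chi m - 1) * gauss_sum q chi n = 0"
    by (simp add: left_diff_distrib)
  then show ?thesis using m(3) by simp
qed

lemma gauss_sum_primitive:
  assumes prim: "primitive_char q chi"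
  shows "gauss_sum q chi n = cnj (chi n) * gauss_sum q chi 1"
proof (cases "coprime n q")
  case True
  note chi = primitive_charD[OF prim]
  have "cnj (chi n) * gauss_sum q chi 1 = (chi n * cnj (chi n)) * gauss_sum q chi n"
    using gauss_sum_twist[OF chi True, of 1] by (simp add: mult_ac)
  then show ?thesis using dirichlet_char_mult_cnj[OF chi, of n] True by simp
next
  case False
  then show ?thesis
    using gauss_sum_not_coprime[OF prim] dirichlet_char_zero_iff[OF primitive_charD[OF prim]] by simp
qed

text \<open>The mean square of \<open>gauss_sum q chi n\<close> over \<open>n\<close> is computed
  twice, by Parseval and by \<open>gauss_sum_primitive\<close>; the positive factor
  \<open>?\<Phi>\<close> cancels.\<close>

lemma norm_gauss_sum_primitive:
  assumes prim: "primitive_char q chi"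
  shows "(cmod (gauss_sum q chi 1))\<^sup>2 = real q"
proof -
  note chi = primitive_charD[OF prim]
  let ?\<Phi> = "\<Sum>n<q. (cmod (chi n))\<^sup>2"
  have q: "q > 0" using dirichlet_char_pos[OF chi] .
  have "?\<Phi> > 0"
  \<comment> \<open>The residue \<open>1 mod q\<close> replaces 1, which is out of range when
    \<open>q = 1\<close>.\<close>
  proof (rule sum_pos2[of _ "1 mod q"])
    show "0 < (cmod (chi (1 mod q)))\<^sup>2"
      using periodic_modD[OF dirichlet_char_periodic[OF chi], of "1 mod q" 1] dirichlet_char_one[OF chi]
      by (simp add: cong_def)
  qed (use q in auto)
  moreover have "real q * ?\<Phi> = (\<Sum>n<q. (cmod (gauss_sum q chi n))\<^sup>2)"
    unfolding gauss_sum_def by (rule parseval_mod[symmetric])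
  moreover have "\<dots> = ?\<Phi> * (cmod (gauss_sum q chi 1))\<^sup>2"
    by (subst gauss_sum_primitive[OF prim]) (simp add: norm_mult power_mult_distrib sum_distrib_right)
  ultimately show ?thesis by (simp add: mult.commute)
qed

text \<open>The Chinese remainder parametrisation factors the additive character, at the price of
  twisting \<open>f\<close> by \<open>r\<close> and \<open>g\<close> by \<open>q\<close>.\<close>

lemma gauss_sum_mult:
  assumes "periodic_mod q f" "periodic_mod r g" "coprime q r" "q > 0" "r > 0"
  shows "gauss_sum (q * r) (\<lambda>c. f c * g c) n
    = gauss_sum q (\<lambda>a. f (a * r)) n * gauss_sum r (\<lambda>b. g (b * q)) n"
proof -
  have lift: "periodic_mod (q * r) f" "periodic_mod (q * r) g"
    using assms(1,2) unfolding periodic_mod_def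
    by (meson cong_modulus_mult_nat, metis cong_modulus_mult_nat mult.commute)
  have "gauss_sum (q * r) (\<lambda>c. f c * g c) n
    = (\<Sum>a<q. \<Sum>b<r. f (a * r + b * q) * g (a * r + b * q) * add_char (q * r) ((a * r + b * q) * n))"
    unfolding gauss_sum_def using assms lift
    by (intro sum_mod_crt periodic_gauss_summand periodic_mod_mult) auto
  also have "\<dots> = (\<Sum>a<q. \<Sum>b<r. (f (a * r) * add_char q (a * n)) * (g (b * q) * add_char r (b * n)))"
  proof (intro sum.cong refl)
    fix a b
    have "add_char (q * r) ((a * r + b * q) * n) = add_char (q * r) ((a * n) * r) * add_char (r * q) ((b * n) * q)"
      by (simp add: add_char_add[symmetric] algebra_simps)
    also have "\<dots> = add_char q (a * n) * add_char r (b * n)"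
      using assms by (simp only: add_char_mult_cancel)
    finally show "f (a * r + b * q) * g (a * r + b * q) * add_char (q * r) ((a * r + b * q) * n)
      = (f (a * r) * add_char q (a * n)) * (g (b * q) * add_char r (b * n))"
      using periodic_modD[OF assms(1), of "a * r + b * q" "a * r"] periodic_modD[OF assms(2), of "a * r + b * q" "b * q"]
      by (simp add: cong_def mult_ac)
  qed
  finally show ?thesis by (simp add: gauss_sum_def sum_product)
qed

text \<open>This is the principal character modulo \<open>r\<close>; its \<open>gauss_sum\<close> is
  the Ramanujan sum.\<close>

abbreviation coprime_ind :: "nat \<Rightarrow> nat \<Rightarrow> complex" where
  "coprime_ind r c \<equiv> of_bool (coprime c r)"

lemma ramanujan_sum_mult:
  assumes "coprime q r" "q > 0" "r > 0"
  shows "gauss_sum (q * r) (coprime_ind (q * r)) n = gauss_sum q (coprime_ind q) n * gauss_sum r (coprime_ind r) n"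
proof -
  have "gauss_sum (q * r) (coprime_ind (q * r)) n = gauss_sum (q * r) (\<lambda>c. coprime_ind q c * coprime_ind r c) n"
    by (intro arg_cong2[where f="gauss_sum (q*r)"] ext) auto
  also have "\<dots> = gauss_sum q (\<lambda>a. coprime_ind q (a * r)) n * gauss_sum r (\<lambda>b. coprime_ind r (b * q)) n"
    by (intro gauss_sum_mult periodic_mod_coprime assms)
  finally show ?thesis using assms by (simp add: coprime_commute)
qed

text \<open>The Ramanujan sum at 1 is multiplicative and equals -1 at every prime. The induction
  splits off one prime factor, coprime to the rest by squarefreeness.\<close>

lemma norm_ramanujan_sum_squarefree:
  assumes "squarefree r"
  shows "cmod (gauss_sum r (coprime_ind r) 1) = 1"
  using assms
proof (induction r rule: less_induct)
  case (less r)
  show ?case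
  proof (cases "r = 1")
    case True
    then show ?thesis by (simp add: gauss_sum_def add_char_def)
  next
    case False
    then obtain p where p: "prime p" "p dvd r" using prime_factor_nat by blast
    then obtain s where r: "r = p * s" by auto
    have s: "s > 0" using less.prems r by (cases "s = 0") auto
    have "\<not> p dvd s"
    proof
      assume "p dvd s"
      then have "p ^ 2 dvd r" by (simp add: r power2_eq_square)
      then show False using less.prems p(1) squarefreeD by (metis not_prime_unit)
    qed
    then have cop: "coprime p s" using p(1) by (simp add: prime_imp_coprime)
    have p1: "p > 1" using p(1) prime_gt_1_nat by blast
    \<comment> \<open>Orthogonality of the frequencies 1 and 0 makes the sum of all
      \<open>p\<close>-th roots of unity vanish; removing the term 1 at \<open>c = 0\<close> leaves
      -1.\<close>
    have "gauss_sum p (\<lambda>_. 1) 1 = (\<Sum>c<p. add_char p (1 * c) * cnj (add_char p (0 * c)))"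
      by (simp add: gauss_sum_def) (simp add: add_char_def)
    also have "\<dots> = 0" by (subst add_char_orthogonal) (use p1 in auto)
    finally have "0 = (\<Sum>c<p. add_char p c)" by (simp add: gauss_sum_def)
    also have "{..<p} = insert 0 {0<..<p}" using p1 by auto
    finally have "(\<Sum>c\<in>{0<..<p}. add_char p c) = -1"
      by (simp add: add_char_def eq_neg_iff_add_eq_0 add.commute)
    moreover have "gauss_sum p (coprime_ind p) 1 = (\<Sum>c\<in>{0<..<p}. add_char p c)"
    proof -
      have "coprime c p \<longleftrightarrow> c \<noteq> 0" if "c < p" for c
      proof (cases "c = 0")
        case False
        then have "\<not> p dvd c" using that by (auto dest: nat_dvd_not_less)
        then have "coprime p c" using p(1) by (rule prime_imp_coprime[rotated])
        then show ?thesis using False by (simp add: coprime_commute)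
      qed (use p1 in simp)
      then show ?thesis unfolding gauss_sum_def
        by (intro sum.mono_neutral_cong_right) auto
    qed
    ultimately have "cmod (gauss_sum p (coprime_ind p) 1) = 1" by simp
    moreover have "cmod (gauss_sum s (coprime_ind s) 1) = 1"
    proof (rule less.IH)
      show "s < r" using r s p1 by simp
      show "squarefree s" using less.prems r squarefree_multD by blast
    qed
    ultimately show ?thesis
      using ramanujan_sum_mult[OF cop, of 1] s p1 by (simp add: r norm_mult)
  qed
qed

lemma ramanujan_sum_coprime:
  assumes "r > 0" "coprime n r"
  shows "gauss_sum r (coprime_ind r) n = gauss_sum r (coprime_ind r) 1"
proof -
  have "gauss_sum r (coprime_ind r) 1 = (\<Sum>c<r. coprime_ind r (c * n) * add_char r (c * n * 1))"
    unfolding gauss_sum_def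
    by (intro sum_mod_mult[symmetric] periodic_gauss_summand periodic_mod_coprime assms)
  also have "\<dots> = gauss_sum r (coprime_ind r) n"
    using assms by (simp add: gauss_sum_def)
  finally show ?thesis by simp
qed

section \<open>Characters induced to a larger modulus\<close>

definition induced_char :: "nat \<Rightarrow> (nat \<Rightarrow> complex) \<Rightarrow> nat \<Rightarrow> complex" where
  "induced_char r chi c = chi c * of_bool (coprime c r)"

lemma induced_char:
  assumes chi: "dirichlet_char q chi" and "r > 0"
  shows "dirichlet_char (q * r) (induced_char r chi)"
  unfolding dirichlet_char_def
proof (intro conjI allI)
  fix m n
  show "q * r > 0" using assms dirichlet_char_pos[OF chi] by simp
  show "induced_char r chi (m * n) = induced_char r chi m * induced_char r chi n"
    by (auto simp: induced_char_def dirichlet_char_mult[OF chi])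
  have "chi (n + q * r) = chi n"
    by (rule periodic_modD[OF dirichlet_char_periodic[OF chi]]) (simp add: cong_def)
  moreover have "coprime (n + q * r) r \<longleftrightarrow> coprime n r"
    by (metis coprime_iff_gcd_eq_1 gcd_add_mult gcd.commute mult.commute add.commute)
  ultimately show "induced_char r chi (n + q * r) = induced_char r chi n"
    by (simp add: induced_char_def)
  show "(induced_char r chi n = 0) = (\<not> coprime n (q * r))"
    by (auto simp: induced_char_def dirichlet_char_zero_iff[OF chi])
qed

text \<open>The sum factors into a Gauss sum modulo \<open>q\<close> and a Ramanujan sum modulo
  \<open>r\<close>, the latter constant on \<open>n\<close> coprime to \<open>r\<close>. Of the
  three factors of \<open>\<kappa>\<close>, only the primitive Gauss sum has modulus different from
  1 in general.\<close>

lemma gauss_sum_induced: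
  assumes prim: "primitive_char q chi" and r: "squarefree r" "coprime q r"
  obtains \<kappa> where "(cmod \<kappa>)\<^sup>2 = real q"
    "\<And>n. coprime n r \<Longrightarrow> gauss_sum (q * r) (induced_char r chi) n = \<kappa> * cnj (chi n)"
proof
  note chi = primitive_charD[OF prim]
  have q: "q > 0" using dirichlet_char_pos[OF chi] .
  have r0: "r > 0" using r(1) by (cases "r = 0") auto
  define \<kappa> where "\<kappa> = chi r * gauss_sum q chi 1 * gauss_sum r (coprime_ind r) 1"
  have "cmod (chi r) = 1" using norm_dirichlet_char[OF chi, of r] r(2) by (simp add: coprime_commute)
  then show "(cmod \<kappa>)\<^sup>2 = real q"
    using norm_gauss_sum_primitive[OF prim] norm_ramanujan_sum_squarefree[OF r(1)]
    by (simp add: \<kappa>_def norm_mult)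
  fix n assume n: "coprime n r"
  have "gauss_sum (q * r) (induced_char r chi) n = gauss_sum (q * r) (\<lambda>c. chi c * coprime_ind r c) n"
    by (simp add: gauss_sum_def induced_char_def)
  also have "\<dots> = gauss_sum q (\<lambda>a. chi (a * r)) n * gauss_sum r (\<lambda>b. coprime_ind r (b * q)) n"
    by (intro gauss_sum_mult dirichlet_char_periodic[OF chi] periodic_mod_coprime r q r0)
  also have "gauss_sum q (\<lambda>a. chi (a * r)) n = chi r * gauss_sum q chi n"
    by (simp add: gauss_sum_def dirichlet_char_mult[OF chi] sum_distrib_left mult_ac)
  also have "gauss_sum r (\<lambda>b. coprime_ind r (b * q)) n = gauss_sum r (coprime_ind r) n"
    using r by (simp add: gauss_sum_def)
  finally show "gauss_sum (q * r) (induced_char r chi) n = \<kappa> * cnj (chi n)"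
    using gauss_sum_primitive[OF prim, of n] ramanujan_sum_coprime[OF r0 n] by (simp add: \<kappa>_def mult_ac)
qed

text \<open>
  A character agreeing with characters modulo \<open>q1\<close> and \<open>q2\<close> is trivial on the classes that are 1
  modulo \<open>gcd q1 q2\<close>, so primitivity forces \<open>gcd q1 q2 = q1\<close>.
\<close>
lemma primitive_modulus_dvd:
  assumes prim: "primitive_char q1 chi1" and chi2: "dirichlet_char q2 chi2"
    and k: "q1 * r1 = q2 * r2" and cop: "coprime q1 r1" "coprime q2 r2"
    and eq: "induced_char r1 chi1 = induced_char r2 chi2"
  shows "q1 dvd q2"
proof -
  note chi1 = primitive_charD[OF prim]
  have "chi1 n = 1" if n: "coprime n q1" "[n = 1] (mod (gcd q1 q2))" for n
  proof -
    \<comment> \<open>Lifting \<open>n\<close> to a unit modulo \<open>q1 * r1\<close> puts it where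
      both induced characters agree with \<open>chi1\<close> and \<open>chi2\<close>.\<close>
    obtain m where m: "[m = n] (mod q1)" "[m = 1] (mod r1)"
      using binary_chinese_remainder_nat[OF cop(1)] by blast
    have "coprime m q1" "coprime m r1"
      using n m cong_imp_coprime cong_sym coprime_1_left by metis+
    then have mk: "coprime m (q1 * r1)" by simp
    \<comment> \<open>As \<open>q2\<close> divides \<open>q1 * r1\<close>, it divides the product of
      its gcds with \<open>q1\<close> and \<open>r1\<close>; \<open>m\<close> is 1 modulo each of
      these coprime gcds.\<close>
    obtain u v where uv: "q2 = u * v" "u dvd q1" "v dvd r1"
      using division_decomp[of q2 q1 r1] k by auto
    then have "u dvd gcd q1 q2" "v dvd gcd r1 q2" by simp_all
    then have "q2 dvd gcd q1 q2 * gcd r1 q2" unfolding uv(1) by (rule mult_dvd_mono)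
    have "[m = 1] (mod (gcd q1 q2))"
      using m(1) n(2) by (meson cong_dvd_modulus_nat cong_trans gcd_dvd1)
    moreover have "[m = 1] (mod (gcd r1 q2))"
      using m(2) by (meson cong_dvd_modulus_nat gcd_dvd1)
    moreover have "coprime (gcd q1 q2) (gcd r1 q2)"
      using cop(1) by (meson coprime_divisors gcd_dvd1)
    ultimately have "[m = 1] (mod (gcd q1 q2 * gcd r1 q2))"
      by (rule coprime_cong_mult_nat)
    then have "[m = 1] (mod q2)" using \<open>q2 dvd _\<close> by (rule cong_dvd_modulus_nat)
    then have "chi2 m = 1"
      using periodic_modD[OF dirichlet_char_periodic[OF chi2]] dirichlet_char_one[OF chi2] by metis
    moreover have "induced_char r1 chi1 m = chi1 m" "induced_char r2 chi2 m = chi2 m"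
      using mk mk[unfolded k] by (simp_all add: induced_char_def)
    ultimately have "chi1 m = 1" using eq by metis
    then show ?thesis using periodic_modD[OF dirichlet_char_periodic[OF chi1] m(1)] by simp
  qed
  then have "\<not> gcd q1 q2 < q1" using prim unfolding primitive_char_def by (meson gcd_dvd1)
  moreover have "gcd q1 q2 \<le> q1" using dirichlet_char_pos[OF chi1] by (simp add: dvd_imp_le)
  ultimately have "gcd q1 q2 = q1" by simp
  then show ?thesis by (metis gcd_dvd2)
qed

text \<open>Divisibility in both directions gives equal moduli. The characters are then compared at
  a lift of each unit modulo \<open>q1\<close> to a number coprime to \<open>r1\<close>.\<close>

lemma induced_char_inj:
  assumes prim: "primitive_char q1 chi1" "primitive_char q2 chi2"
    and k: "q1 * r1 = q2 * r2" and cop: "coprime q1 r1" "coprime q2 r2"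
    and eq: "induced_char r1 chi1 = induced_char r2 chi2"
  shows "q1 = q2 \<and> chi1 = chi2"
proof -
  note chi = prim[THEN primitive_charD]
  have q: "q1 = q2"
    using primitive_modulus_dvd[OF prim(1) chi(2) k cop eq]
      primitive_modulus_dvd[OF prim(2) chi(1) k[symmetric] cop(2,1) eq[symmetric]] by (rule dvd_antisym)
  then have r: "r1 = r2" using k dirichlet_char_pos[OF chi(1)] by simp
  have "chi1 n = chi2 n" for n
  proof (cases "coprime n q1")
    case True
    obtain m where m: "[m = n] (mod q1)" "[m = 1] (mod r1)"
      using binary_chinese_remainder_nat[OF cop(1)] by blast
    have "coprime m r1" using m cong_imp_coprime cong_sym coprime_1_left by metis
    then have "chi1 m = chi2 m" using fun_cong[OF eq, of m] by (simp add: induced_char_def r)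
    then show ?thesis
      using periodic_modD[OF dirichlet_char_periodic[OF chi(1)] m(1)]
        periodic_modD[OF dirichlet_char_periodic[OF chi(2)] m(1)[unfolded q]] by simp
  next
    case False
    then show ?thesis
      using dirichlet_char_zero_iff[OF chi(1)] dirichlet_char_zero_iff[OF chi(2)] q by metis
  qed
  then show ?thesis using q by blast
qed

subsection \<open>Sums over squarefree numbers\<close>

definition smooth_upto :: "nat set \<Rightarrow> nat \<Rightarrow> nat set" where
  "smooth_upto P y = {n \<in> {1..y}. prime_factors n \<subseteq> P}"

definition sqf_upto :: "nat \<Rightarrow> nat \<Rightarrow> nat set" where
  "sqf_upto q y = {r \<in> {1..y}. squarefree r \<and> coprime q r}"

lemma finite_upto [simp]: "finite (smooth_upto P y)" "finite (sqf_upto q y)"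
  by (auto simp: smooth_upto_def sqf_upto_def)

text \<open>
  Both inequalities follow from \<open>S' y \<le> S y + S' (y div p) / p\<close>, where \<open>S\<close> and \<open>S'\<close> are the sums over
  the numbers composed of primes in \<open>P\<close> and in \<open>insert p P\<close>.
\<close>
lemma smooth_sum_step:
  assumes p: "prime p"
  shows "(1 - 1 / real p) * (\<Sum>n\<in>smooth_upto (insert p P) y. 1 / real n) \<le> (\<Sum>n\<in>smooth_upto P y. 1 / real n)"
    and "(\<Sum>n\<in>smooth_upto (insert p P) y. 1 / real n)
      \<le> (\<Sum>n\<in>smooth_upto P y. 1 / real n) + 1 / (real p - 1) * (\<Sum>n\<in>smooth_upto P (y div p). 1 / real n)"
proof -
  define S where "S P y = (\<Sum>n\<in>smooth_upto P y. 1 / real n)" for P y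
  have p1: "p > 1" using p by (rule prime_gt_1_nat)
  have rec: "S (insert p P) y \<le> S P y + 1 / real p * S (insert p P) (y div p)" for y
  proof -
    have sub: "smooth_upto (insert p P) y \<subseteq> smooth_upto P y \<union> (*) p ` smooth_upto (insert p P) (y div p)"
    proof
      fix n assume n: "n \<in> smooth_upto (insert p P) y"
      show "n \<in> smooth_upto P y \<union> (*) p ` smooth_upto (insert p P) (y div p)"
      proof (cases "p dvd n")
        case True
        then obtain m where m: "n = p * m" by auto
        have "m \<in> smooth_upto (insert p P) (y div p)"
          using n p1 m dvd_prime_factors[of n m]
          by (auto simp: smooth_upto_def less_eq_div_iff_mult_less_eq mult.commute intro!: Nat.gr0I)
        then show ?thesis using m by blast
      next
        case False
        then have "p \<notin> prime_factors n" by auto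
        then show ?thesis using n by (auto simp: smooth_upto_def)
      qed
    qed
    have "S (insert p P) y \<le> (\<Sum>n\<in>smooth_upto P y \<union> (*) p ` smooth_upto (insert p P) (y div p). 1 / real n)"
      unfolding S_def using sub by (intro sum_mono2) auto
    also have "\<dots> \<le> S P y + (\<Sum>n\<in>(*) p ` smooth_upto (insert p P) (y div p). 1 / real n)"
      unfolding S_def by (subst sum_Un) (auto intro: sum_nonneg)
    also have "(\<Sum>n\<in>(*) p ` smooth_upto (insert p P) (y div p). 1 / real n) = 1 / real p * S (insert p P) (y div p)"
      using p1 by (subst sum.reindex) (auto simp: inj_on_def S_def sum_distrib_left)
    finally show ?thesis .
  qed
  have mono: "S (insert p P) (y div p) \<le> S (insert p P) y" for y
    unfolding S_def using div_le_dividend[of y p]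
    by (intro sum_mono2) (auto simp: smooth_upto_def intro: order_trans)
  have *: "(1 - 1 / real p) * S (insert p P) y \<le> S P y" for y
  proof -
    have "1 / real p * S (insert p P) (y div p) \<le> 1 / real p * S (insert p P) y"
      by (intro mult_left_mono mono) simp
    with rec[of y] show ?thesis by (simp add: left_diff_distrib)
  qed
  show "(1 - 1 / real p) * (\<Sum>n\<in>smooth_upto (insert p P) y. 1 / real n) \<le> (\<Sum>n\<in>smooth_upto P y. 1 / real n)"
    using * unfolding S_def .
  \<comment> \<open>The first inequality, applied at \<open>y div p\<close>, replaces the sum over
    the larger set on the right of \<open>rec\<close>; the factor becomes
    \<open>(1 / p) / (1 - 1 / p) = 1 / (p - 1)\<close>.\<close>
  have "1 / real p * S (insert p P) (y div p) = 1 / (real p - 1) * ((1 - 1 / real p) * S (insert p P) (y div p))"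
    using p1 by (simp add: field_simps)
  also have "\<dots> \<le> 1 / (real p - 1) * S P (y div p)"
    using p1 by (intro mult_left_mono *) simp
  finally show "(\<Sum>n\<in>smooth_upto (insert p P) y. 1 / real n)
      \<le> (\<Sum>n\<in>smooth_upto P y. 1 / real n) + 1 / (real p - 1) * (\<Sum>n\<in>smooth_upto P (y div p). 1 / real n)"
    using rec[of y] unfolding S_def by linarith
qed

text \<open>Multiplication by \<open>p\<close> sends the second family to multiples of
  \<open>p\<close>, disjoint from the first, and
  \<open>totient (p * r) = (p - 1) * totient r\<close>. The shape matches the second inequality of
  \<open>smooth_sum_step\<close>.\<close>

lemma sqf_sum_step:
  assumes p: "prime p" "p \<notin> P" "\<not> p dvd q"
  shows "(\<Sum>r\<in>sqf_upto q y \<inter> smooth_upto P y. 1 / real (totient r))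
      + 1 / (real p - 1) * (\<Sum>r\<in>sqf_upto q (y div p) \<inter> smooth_upto P (y div p). 1 / real (totient r))
    \<le> (\<Sum>r\<in>sqf_upto q y \<inter> smooth_upto (insert p P) y. 1 / real (totient r))"
proof -
  let ?A = "sqf_upto q y \<inter> smooth_upto P y"
  let ?B = "sqf_upto q (y div p) \<inter> smooth_upto P (y div p)"
  have p1: "p > 1" using p(1) by (rule prime_gt_1_nat)
  have ndvd: "\<not> p dvd r" if "r \<in> smooth_upto P z" for r z
    using that p(1,2) by (auto simp: smooth_upto_def prime_factors_dvd)
  have cop: "coprime p r" if "r \<in> ?B" for r
    using ndvd that p(1) by (auto intro: prime_imp_coprime)
  have "coprime q p" using p(1,3) prime_imp_coprime coprime_commute by blast
  have sub: "?A \<union> (*) p ` ?B \<subseteq> sqf_upto q y \<inter> smooth_upto (insert p P) y"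
  proof -
    have "p * r \<in> sqf_upto q y \<inter> smooth_upto (insert p P) y" if r: "r \<in> ?B" for r
    proof -
      have "prime_factors (p * r) = insert p (prime_factors r)"
        using r p(1) p1 by (subst prime_factors_product) (auto simp: prime_prime_factors smooth_upto_def)
      moreover have "squarefree (p * r)"
        using r cop[OF r] p(1) by (auto simp: sqf_upto_def intro: squarefree_mult_coprime squarefree_prime)
      moreover have "p * r \<le> y"
        using r p1 by (simp add: sqf_upto_def less_eq_div_iff_mult_less_eq mult.commute)
      ultimately show ?thesis using r p1 \<open>coprime q p\<close> by (auto simp: sqf_upto_def smooth_upto_def)
    qed
    then show ?thesis by (auto simp: smooth_upto_def)
  qed
  have "1 / (real p - 1) * (\<Sum>r\<in>?B. 1 / real (totient r)) = (\<Sum>r\<in>?B. 1 / real (totient (p * r)))"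
    unfolding sum_distrib_left
    using p1 p(1) cop by (intro sum.cong refl) (simp add: totient_mult_coprime totient_prime of_nat_diff)
  also have "\<dots> = (\<Sum>r\<in>(*) p ` ?B. 1 / real (totient r))"
    using p1 by (subst sum.reindex) (auto simp: inj_on_def)
  finally have "(\<Sum>r\<in>?A. 1 / real (totient r)) + 1 / (real p - 1) * (\<Sum>r\<in>?B. 1 / real (totient r))
      = (\<Sum>r\<in>?A. 1 / real (totient r)) + (\<Sum>r\<in>(*) p ` ?B. 1 / real (totient r))" by simp
  also have "\<dots> = (\<Sum>r\<in>?A \<union> (*) p ` ?B. 1 / real (totient r))"
    by (intro sum.union_disjoint[symmetric]) (auto dest!: ndvd)
  also have "\<dots> \<le> (\<Sum>r\<in>sqf_upto q y \<inter> smooth_upto (insert p P) y. 1 / real (totient r))"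
    using sub by (intro sum_mono2) auto
  finally show ?thesis .
qed

text \<open>Untruncated, \<open>1 / totient r\<close> is the sum of \<open>1 / n\<close> over all
  \<open>n\<close> with the same prime factors as \<open>r\<close>. The induction adds one prime at
  a time: a prime dividing \<open>q\<close> uses the first inequality of
  \<open>smooth_sum_step\<close>, any other pairs the second with \<open>sqf_sum_step\<close>. The
  bound \<open>y\<close> is arbitrary because the step also needs \<open>y div p\<close>.\<close>

lemma smooth_sum_le_sqf_sum:
  assumes "finite P" "\<And>p. p \<in> P \<Longrightarrow> prime p"
  shows "(\<Prod>p\<in>{p\<in>P. p dvd q}. 1 - 1 / real p) * (\<Sum>n\<in>smooth_upto P y. 1 / real n)
    \<le> (\<Sum>r\<in>sqf_upto q y \<inter> smooth_upto P y. 1 / real (totient r))"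
  using assms
proof (induction P arbitrary: y)
  case empty
  have one: "n = 1" if "n \<in> smooth_upto {} y" for n
    using that by (auto simp: smooth_upto_def prime_factorization_empty_iff)
  have "1 \<in> sqf_upto q y" if "1 \<in> smooth_upto {} y"
    using that by (simp add: smooth_upto_def sqf_upto_def)
  then have "sqf_upto q y \<inter> smooth_upto {} y = smooth_upto {} y" using one by blast
  moreover have "(\<Sum>n\<in>smooth_upto {} y. 1 / real n) = (\<Sum>n\<in>smooth_upto {} y. 1 / real (totient n))"
  proof (rule sum.cong[OF refl])
    fix n assume "n \<in> smooth_upto {} y"
    then have "n = 1" by (rule one)
    then show "1 / real n = 1 / real (totient n)" by simp
  qed
  ultimately show ?case by simp
next
  case (insert p P)
  have p: "prime p" using insert.prems by simp
  have p1: "p > 1" using p by (rule prime_gt_1_nat)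
  let ?\<pi> = "\<Prod>p\<in>{p\<in>P. p dvd q}. 1 - 1 / real p"
  have IH: "?\<pi> * (\<Sum>n\<in>smooth_upto P z. 1 / real n) \<le> (\<Sum>r\<in>sqf_upto q z \<inter> smooth_upto P z. 1 / real (totient r))" for z
    using insert.prems by (intro insert.IH) auto
  have pi0: "?\<pi> \<ge> 0"
  proof (rule prod_nonneg)
    fix x assume "x \<in> {p\<in>P. p dvd q}"
    then have "x > 1" using insert.prems prime_gt_1_nat by auto
    then show "0 \<le> 1 - 1 / real x" by simp
  qed
  show ?case
  proof (cases "p dvd q")
    case True
    then have "{x \<in> insert p P. x dvd q} = insert p {x\<in>P. x dvd q}" by auto
    then have "(\<Prod>p\<in>{x \<in> insert p P. x dvd q}. 1 - 1 / real p) = (1 - 1 / real p) * ?\<pi>"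
      using insert.hyps by simp
    then have "(\<Prod>p\<in>{x \<in> insert p P. x dvd q}. 1 - 1 / real p) * (\<Sum>n\<in>smooth_upto (insert p P) y. 1 / real n)
       = ?\<pi> * ((1 - 1 / real p) * (\<Sum>n\<in>smooth_upto (insert p P) y. 1 / real n))" by simp
    also have "\<dots> \<le> ?\<pi> * (\<Sum>n\<in>smooth_upto P y. 1 / real n)"
      by (intro mult_left_mono smooth_sum_step p pi0)
    also have "\<dots> \<le> (\<Sum>r\<in>sqf_upto q y \<inter> smooth_upto P y. 1 / real (totient r))" by (rule IH)
    also have "\<dots> \<le> (\<Sum>r\<in>sqf_upto q y \<inter> smooth_upto (insert p P) y. 1 / real (totient r))"
      by (intro sum_mono2) (auto simp: smooth_upto_def)
    finally show ?thesis .
  next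
    case False
    then have "{x \<in> insert p P. x dvd q} = {x\<in>P. x dvd q}" by auto
    then have "(\<Prod>p\<in>{x \<in> insert p P. x dvd q}. 1 - 1 / real p) * (\<Sum>n\<in>smooth_upto (insert p P) y. 1 / real n)
       = ?\<pi> * (\<Sum>n\<in>smooth_upto (insert p P) y. 1 / real n)" by simp
    also have "\<dots> \<le> ?\<pi> * ((\<Sum>n\<in>smooth_upto P y. 1 / real n) + 1 / (real p - 1) * (\<Sum>n\<in>smooth_upto P (y div p). 1 / real n))"
      by (intro mult_left_mono smooth_sum_step p pi0)
    also have "\<dots> = ?\<pi> * (\<Sum>n\<in>smooth_upto P y. 1 / real n) + 1 / (real p - 1) * (?\<pi> * (\<Sum>n\<in>smooth_upto P (y div p). 1 / real n))"
      by (simp add: algebra_simps)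
    also have "\<dots> \<le> (\<Sum>r\<in>sqf_upto q y \<inter> smooth_upto P y. 1 / real (totient r))
      + 1 / (real p - 1) * (\<Sum>r\<in>sqf_upto q (y div p) \<inter> smooth_upto P (y div p). 1 / real (totient r))"
      using p1 by (intro add_mono mult_left_mono IH) auto
    also have "\<dots> \<le> (\<Sum>r\<in>sqf_upto q y \<inter> smooth_upto (insert p P) y. 1 / real (totient r))"
      using p insert.hyps False by (intro sqf_sum_step) auto
    finally show ?thesis .
  qed
qed

lemma harm_le_sqf_sum:
  assumes "q > 0"
  shows "harm y \<le> real q / real (totient q) * (\<Sum>r\<in>sqf_upto q y. 1 / real (totient r))"
proof -
  \<comment> \<open>Prime divisors of \<open>q\<close> above \<open>y\<close> are included so that
    the product is exactly \<open>totient q / q\<close>; the primes up to \<open>y\<close> make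
    every number in \<open>{1..y}\<close> smooth.\<close>
  define P where "P = {p. prime p \<and> (p \<le> y \<or> p dvd q)}"
  let ?G = "\<Sum>r\<in>sqf_upto q y. 1 / real (totient r)"
  have finP: "finite P" using assms finite_divisors_nat[of q] by (auto simp: P_def)
  have Pq: "{p\<in>P. p dvd q} = prime_factors q" using assms by (auto simp: P_def prime_factors_dvd)
  have smooth: "smooth_upto P y = {1..y}"
    by (auto simp: smooth_upto_def P_def prime_factors_dvd dest!: dvd_imp_le)
  have "real (totient q) / real q = (\<Prod>p\<in>{p\<in>P. p dvd q}. 1 - 1 / real p)"
    using assms by (simp add: totient_formula2 Pq)
  moreover have "harm y = (\<Sum>n\<in>smooth_upto P y. 1 / real n)"
    by (simp add: harm_def smooth inverse_eq_divide)
  ultimately have "real (totient q) / real q * harm y \<le> (\<Sum>r\<in>sqf_upto q y \<inter> smooth_upto P y. 1 / real (totient r))"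
    using smooth_sum_le_sqf_sum[OF finP, of q y] by (simp add: P_def)
  also have "\<dots> \<le> ?G" by (intro sum_mono2) auto
  finally show ?thesis using assms by (simp add: field_simps)
qed

subsection \<open>The multiplicative large sieve\<close>

text \<open>The difference is an integer \<open>m\<close> over \<open>k * l\<close>. If
  \<open>m = 0\<close>, then \<open>z = 0\<close> because both fractions lie in [0,1), and equal
  fractions in lowest terms have equal denominators and numerators.\<close>

lemma farey_spacing:
  fixes k l c d K :: nat and z :: int
  assumes k: "0 < k" "k \<le> K" and l: "0 < l" "l \<le> K" and c: "c < k" "coprime c k" and d: "d < l" "coprime d l"
    and ne: "(k, c) \<noteq> (l, d)"
  shows "\<bar>real c / real k - real d / real l - of_int z\<bar> \<ge> 1 / real (K\<^sup>2)"
proof -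
  define m where "m = int c * int l - int d * int k - z * int k * int l"
  have eq: "real c / real k - real d / real l - of_int z = of_int m / (real k * real l)"
    using k l by (simp add: m_def field_simps)
  have "m \<noteq> 0"
  proof
    assume "m = 0"
    then have e: "real c / real k - real d / real l = of_int z" using eq by simp
    have "0 \<le> real c / real k" "real c / real k < 1" "0 \<le> real d / real l" "real d / real l < 1"
      using c d by auto
    then have "z = 0" using e by linarith
    then have "int c * int l = int d * int k" using \<open>m = 0\<close> by (simp add: m_def)
    then have cl: "c * l = d * k" by (metis of_nat_eq_iff of_nat_mult)
    have "k dvd c * l" "l dvd d * k" using cl by (metis dvd_triv_right)+
    then have "k dvd l" "l dvd k"
      using c(2) d(2) by (metis coprime_commute coprime_dvd_mult_right_iff)+
    then have "k = l" by (rule dvd_antisym)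
    with cl k ne show False by simp
  qed
  then have "1 \<le> \<bar>real_of_int m\<bar>" by linarith
  have "real k * real l \<le> real K * real K" using k l by (intro mult_mono) auto
  then have "1 / real (K\<^sup>2) \<le> 1 / (real k * real l)"
    using k l by (intro divide_left_mono) (auto simp: power2_eq_square)
  also have "\<dots> \<le> \<bar>real_of_int m\<bar> / (real k * real l)"
    using \<open>1 \<le> _\<close> by (intro divide_right_mono) auto
  finally show ?thesis unfolding eq by (simp add: abs_divide)
qed

text \<open>The points are the Farey fractions of order \<open>K\<close>, which are spaced by
  \<open>1 / K^2\<close> modulo 1.\<close>

lemma large_sieve_additive:
  assumes K: "K\<^sup>2 \<le> N"
  shows "(\<Sum>k\<in>{1..K}. \<Sum>c | c < k \<and> coprime c k. (cmod (\<Sum>n\<in>{1..N}. a n * add_char k (c * n)))\<^sup>2)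
     \<le> 12 * real N * (\<Sum>n\<in>{1..N}. (cmod (a n))\<^sup>2)"
proof (cases "K = 0")
  case False
  define S where "S = Sigma {1..K} (\<lambda>k. {c. c < k \<and> coprime c k})"
  have "(\<Sum>k\<in>{1..K}. \<Sum>c | c < k \<and> coprime c k. (cmod (\<Sum>n\<in>{1..N}. a n * add_char k (c * n)))\<^sup>2)
    = (\<Sum>(k,c)\<in>S. (cmod (\<Sum>n\<in>{1..N}. a n * add_char k (c * n)))\<^sup>2)"
    unfolding S_def by (intro sum.Sigma) auto
  also have "\<dots> = (\<Sum>s\<in>S. (cmod (\<Sum>n\<in>{1..N}. a n * cis (2 * pi * (\<lambda>(k,c). real c / real k) s * real n)))\<^sup>2)"
    by (intro sum.cong refl) (auto simp: add_char_def mult_ac)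
  also have "\<dots> \<le> 12 * real N * (\<Sum>n\<in>{1..N}. (cmod (a n))\<^sup>2)"
  proof (rule large_sieve_points[where L="K\<^sup>2"])
    show "finite S" unfolding S_def by (intro finite_SigmaI) auto
    show "0 < K\<^sup>2" "K\<^sup>2 \<le> N" using False K by auto
    fix s t z assume st: "s \<in> S" "t \<in> S" "s \<noteq> t"
    obtain k c l d where kc: "s = (k, c)" "t = (l, d)" by fastforce
    show "1 / real (K\<^sup>2) \<le> \<bar>(\<lambda>(k,c). real c / real k) s - (\<lambda>(k,c). real c / real k) t - real_of_int z\<bar>"
      unfolding kc prod.case by (rule farey_spacing) (use st in \<open>auto simp: kc S_def\<close>)
  qed
  finally show ?thesis .
qed (simp add: sum_nonneg)

text \<open>For each \<open>k\<close> the triples with \<open>q * r = k\<close> induce distinct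
  characters modulo \<open>k\<close>, to which Bessel's inequality applies. Leaving \<open>R\<close>
  free covers both the weighted and the classical sieve; \<open>supp\<close> is what makes the Gauss
  sum formula usable for every \<open>r\<close>.\<close>

lemma large_sieve_multiplicative:
  fixes X :: "nat \<Rightarrow> (nat \<Rightarrow> complex) set" and R :: "nat \<Rightarrow> nat set"
  assumes K: "K\<^sup>2 \<le> N" and X: "\<And>q. finite (X q)" "\<And>q chi. chi \<in> X q \<Longrightarrow> primitive_char q chi"
    and R: "\<And>q. finite (R q)"
      "\<And>q r. q \<in> {1..Q} \<Longrightarrow> r \<in> R q \<Longrightarrow> squarefree r \<and> coprime q r \<and> q * r \<le> K"
    and supp: "\<And>n q r. n \<in> {1..N} \<Longrightarrow> a n \<noteq> 0 \<Longrightarrow> q \<in> {1..Q} \<Longrightarrow> r \<in> R q \<Longrightarrow> coprime n r"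
  shows "(\<Sum>q\<in>{1..Q}. \<Sum>chi\<in>X q. real q / real (totient q) * (\<Sum>r\<in>R q. 1 / real (totient r)) *
      (cmod (\<Sum>n\<in>{1..N}. a n * cnj (chi n)))\<^sup>2) \<le> 12 * real N * (\<Sum>n\<in>{1..N}. (cmod (a n))\<^sup>2)"
proof -
  define A where "A chi = (cmod (\<Sum>n\<in>{1..N}. a n * cnj (chi n)))\<^sup>2" for chi
  define S where "S k c = (\<Sum>n\<in>{1..N}. a n * add_char k (c * n))" for k c
  define W where "W = Sigma {1..Q} (\<lambda>q. X q \<times> R q)"
  define g where "g = (\<lambda>(q, chi :: nat \<Rightarrow> complex, r). q * r :: nat)"
  \<comment> \<open>The denominator \<open>totient (q * r)\<close> is the factor lost to Bessel's
    inequality modulo \<open>q * r\<close>.\<close>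
  define h where "h = (\<lambda>(q, chi, r). real q * A chi / real (totient (q * r)))"
  have finW: "finite W" unfolding W_def using X R by (intro finite_SigmaI finite_cartesian_product) auto
  have W: "q \<in> {1..Q}" "primitive_char q chi" "squarefree r" "coprime q r" "r > 0" "q > 0" "q * r \<le> K"
    if "(q, chi, r) \<in> W" for q chi r
  proof -
    show "q \<in> {1..Q}" "primitive_char q chi" "squarefree r" "coprime q r" "q > 0" "q * r \<le> K"
      using that X(2) R(2)[of q r] by (auto simp: W_def)
    then show "r > 0" by (cases "r = 0") auto
  qed
  have gW: "g ` W \<subseteq> {1..K}"
    using W by (fastforce simp: g_def)
  have step: "(\<Sum>w | w \<in> W \<and> g w = k. h w) \<le> (\<Sum>c | c < k \<and> coprime c k. (cmod (S k c))\<^sup>2)"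
    if k: "k \<in> {1..K}" for k
  proof -
    let ?I = "{w \<in> W. g w = k}"
    let ?U = "{c. c < k \<and> coprime c k}"
    define \<psi> where "\<psi> = (\<lambda>(q::nat, chi, r). induced_char r chi)"
    have char: "dirichlet_char k (\<psi> w)" if "w \<in> ?I" for w
    proof -
      obtain q chi r where w: "w = (q, chi, r)" by (cases w)
      then show ?thesis using that W[of q chi r] induced_char[of q chi r] primitive_charD
        by (auto simp: \<psi>_def g_def)
    qed
    have inj: "inj_on \<psi> ?I"
    proof (rule inj_onI)
      fix w w' assume ww: "w \<in> ?I" "w' \<in> ?I" "\<psi> w = \<psi> w'"
      obtain q chi r q' chi' r' where w: "w = (q, chi, r)" "w' = (q', chi', r')"
        by (cases w, cases w')
      have k: "q * r = k" "q' * r' = k" and wW: "(q, chi, r) \<in> W" "(q', chi', r') \<in> W"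
        using ww by (auto simp: w g_def)
      have "q = q' \<and> chi = chi'"
        by (rule induced_char_inj[of q chi q' chi' r r']) (use W[OF wW(1)] W[OF wW(2)] k ww(3) in \<open>auto simp: w \<psi>_def\<close>)
      moreover from this have "r = r'" using k W[OF wW(1)] by auto
      ultimately show "w = w'" by (simp add: w)
    qed
    \<comment> \<open>Exchanging summations turns the pairing of \<open>S k\<close> with an induced
      character into Gauss sums, from which the constant \<open>\<kappa>\<close> of squared modulus
      \<open>q\<close> comes out.\<close>
    have val: "(cmod (\<Sum>c\<in>?U. S k c * \<psi> w c))\<^sup>2 = real (totient k) * h w" if w: "w \<in> ?I" for w
    proof -
      obtain q chi r where wq: "w = (q, chi, r)" by (cases w)
      have k: "k = q * r" and wW: "(q, chi, r) \<in> W" using w by (auto simp: wq g_def)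
      note Wq = W[OF wW]
      obtain \<kappa> where \<kappa>: "(cmod \<kappa>)\<^sup>2 = real q"
        "\<And>n. coprime n r \<Longrightarrow> gauss_sum (q * r) (induced_char r chi) n = \<kappa> * cnj (chi n)"
        using gauss_sum_induced[OF Wq(2,3,4)] by blast
      have "r \<in> R q" using wW by (simp add: W_def)
      have "(\<Sum>c\<in>?U. S k c * \<psi> w c) = (\<Sum>c<k. S k c * \<psi> w c)"
        by (rule sum.mono_neutral_left) (use dirichlet_char_zero_iff[OF char[OF w]] in auto)
      also have "\<dots> = (\<Sum>c<k. \<Sum>n\<in>{1..N}. a n * (\<psi> w c * add_char k (c * n)))"
        unfolding S_def sum_distrib_right by (intro sum.cong refl) (simp only: mult_ac)
      also have "\<dots> = (\<Sum>n\<in>{1..N}. a n * gauss_sum k (\<psi> w) n)"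
        by (subst sum.swap) (simp add: gauss_sum_def sum_distrib_left)
      also have "\<dots> = (\<Sum>n\<in>{1..N}. \<kappa> * (a n * cnj (chi n)))"
      proof (rule sum.cong[OF refl])
        fix n assume "n \<in> {1..N}"
        then show "a n * gauss_sum k (\<psi> w) n = \<kappa> * (a n * cnj (chi n))"
          using supp[of n q r] \<open>r \<in> R q\<close> Wq(1) \<kappa>(2)[of n] by (cases "a n = 0") (auto simp: k wq \<psi>_def)
      qed
      also have "\<dots> = \<kappa> * (\<Sum>n\<in>{1..N}. a n * cnj (chi n))" by (simp add: sum_distrib_left)
      finally have "(cmod (\<Sum>c\<in>?U. S k c * \<psi> w c))\<^sup>2 = real q * A chi"
        by (simp add: norm_mult power_mult_distrib \<kappa>(1) A_def)
      then show ?thesis using Wq by (simp add: h_def wq k)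
    qed
    have "real (totient k) * (\<Sum>w\<in>?I. h w) = (\<Sum>w\<in>?I. (cmod (\<Sum>c\<in>?U. S k c * \<psi> w c))\<^sup>2)"
      by (simp add: val sum_distrib_left)
    also have "\<dots> \<le> real (totient k) * (\<Sum>c\<in>?U. (cmod (S k c))\<^sup>2)"
      using k finW inj char by (intro dirichlet_char_bessel) auto
    finally show ?thesis using k by simp
  qed
  have "(\<Sum>q\<in>{1..Q}. \<Sum>chi\<in>X q. real q / real (totient q) * (\<Sum>r\<in>R q. 1 / real (totient r)) * A chi)
    = (\<Sum>q\<in>{1..Q}. \<Sum>chi\<in>X q. \<Sum>r\<in>R q. h (q, chi, r))"
  proof (intro sum.cong refl)
    fix q chi assume q: "q \<in> {1..Q}" "chi \<in> X q"
    have "h (q, chi, r) = real q / real (totient q) * (1 / real (totient r)) * A chi" if "r \<in> R q" for r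
      using R(2)[OF q(1) that] by (simp add: h_def totient_mult_coprime)
    then show "real q / real (totient q) * (\<Sum>r\<in>R q. 1 / real (totient r)) * A chi = (\<Sum>r\<in>R q. h (q, chi, r))"
      by (simp add: sum_distrib_left sum_distrib_right)
  qed
  also have "\<dots> = (\<Sum>w\<in>W. h w)"
    unfolding W_def using X R by (simp add: sum.Sigma sum.cartesian_product case_prod_unfold)
  \<comment> \<open>Sorting the triples by their product lets the bounds for single moduli add up to
    the additive large sieve.\<close>
  also have "\<dots> = (\<Sum>k\<in>{1..K}. \<Sum>w | w \<in> W \<and> g w = k. h w)"
    using sum.group[OF finW _ gW, of h] by simp
  also have "\<dots> \<le> (\<Sum>k\<in>{1..K}. \<Sum>c | c < k \<and> coprime c k. (cmod (S k c))\<^sup>2)"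
    by (intro sum_mono step)
  also have "\<dots> \<le> 12 * real N * (\<Sum>n\<in>{1..N}. (cmod (a n))\<^sup>2)"
    unfolding S_def by (rule large_sieve_additive[OF K])
  finally show ?thesis unfolding A_def .
qed

text \<open>Taking all squarefree \<open>r\<close> up to \<open>K div q\<close> coprime to
  \<open>q\<close> makes the weight of \<open>chi\<close> at least \<open>harm (K div q)\<close>.
  Since \<open>r <= q * r <= K\<close>, the support of \<open>b\<close> is coprime to every such
  \<open>r\<close>.\<close>

lemma large_sieve_rough:
  assumes X: "\<And>q. finite (X q)" "\<And>q chi. chi \<in> X q \<Longrightarrow> primitive_char q chi"
    and K: "K\<^sup>2 \<le> N" and D: "\<And>q. q \<in> {1..Q} \<Longrightarrow> D \<le> harm (K div q)"
    and supp: "\<And>n k. b n \<noteq> 0 \<Longrightarrow> k \<in> {1..K} \<Longrightarrow> coprime n k"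
  shows "D * (\<Sum>q\<in>{1..Q}. \<Sum>chi\<in>X q. (cmod (\<Sum>n\<in>{1..N}. b n * chi n))\<^sup>2)
    \<le> 12 * real N * (\<Sum>n\<in>{1..N}. (cmod (b n))\<^sup>2)"
proof -
  \<comment> \<open>Gauss sums produce \<open>cnj (chi n)\<close>, so the whole sum is conjugated
    before the sieve is applied.\<close>
  have norm: "cmod (\<Sum>n\<in>{1..N}. b n * chi n) = cmod (\<Sum>n\<in>{1..N}. cnj (b n) * cnj (chi n))" for chi
    by (subst complex_mod_cnj[symmetric]) simp
  have "D * (\<Sum>q\<in>{1..Q}. \<Sum>chi\<in>X q. (cmod (\<Sum>n\<in>{1..N}. b n * chi n))\<^sup>2)
    = (\<Sum>q\<in>{1..Q}. \<Sum>chi\<in>X q. D * (cmod (\<Sum>n\<in>{1..N}. cnj (b n) * cnj (chi n)))\<^sup>2)"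
    by (simp only: sum_distrib_left norm)
  also have "\<dots> \<le> (\<Sum>q\<in>{1..Q}. \<Sum>chi\<in>X q. real q / real (totient q) *
      (\<Sum>r\<in>sqf_upto q (K div q). 1 / real (totient r)) * (cmod (\<Sum>n\<in>{1..N}. cnj (b n) * cnj (chi n)))\<^sup>2)"
  proof (intro sum_mono mult_right_mono)
    fix q assume q: "q \<in> {1..Q}"
    then have "harm (K div q) \<le> real q / real (totient q) * (\<Sum>r\<in>sqf_upto q (K div q). 1 / real (totient r))"
      by (intro harm_le_sqf_sum) simp
    with D[OF q] show "D \<le> real q / real (totient q) * (\<Sum>r\<in>sqf_upto q (K div q). 1 / real (totient r))"
      by (rule order_trans)
  qed simp
  also have "\<dots> \<le> 12 * real N * (\<Sum>n\<in>{1..N}. (cmod (cnj (b n)))\<^sup>2)"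
  proof (rule large_sieve_multiplicative[where X=X, OF K X])
    have le: "q * r \<le> K" if "q \<in> {1..Q}" "r \<in> sqf_upto q (K div q)" for q r
      using that by (simp add: sqf_upto_def less_eq_div_iff_mult_less_eq mult.commute)
    show "squarefree r \<and> coprime q r \<and> q * r \<le> K" if "q \<in> {1..Q}" "r \<in> sqf_upto q (K div q)" for q r
      using that le by (simp add: sqf_upto_def)
    show "coprime n r" if "cnj (b n) \<noteq> 0" "q \<in> {1..Q}" "r \<in> sqf_upto q (K div q)" for n q r
    proof (rule supp)
      have "r \<le> q * r" using that(2) by simp
      then show "r \<in> {1..K}" using that(3) le[OF that(2,3)] by (auto simp: sqf_upto_def intro: order_trans)
    qed (use that in simp)
  qed auto
  finally show ?thesis by simp
qed

text \<open>With \<open>r = 1\<close> alone the support condition is vacuous, and the weight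
  \<open>q / totient q\<close> is at least 1.\<close>

lemma large_sieve_classical:
  assumes X: "\<And>q. finite (X q)" "\<And>q chi. chi \<in> X q \<Longrightarrow> primitive_char q chi" and Q: "Q\<^sup>2 \<le> N"
  shows "(\<Sum>q\<in>{1..Q}. \<Sum>chi\<in>X q. (cmod (\<Sum>n\<in>{1..N}. b n * chi n))\<^sup>2)
    \<le> 12 * real N * (\<Sum>n\<in>{1..N}. (cmod (b n))\<^sup>2)"
proof -
  have norm: "cmod (\<Sum>n\<in>{1..N}. b n * chi n) = cmod (\<Sum>n\<in>{1..N}. cnj (b n) * cnj (chi n))" for chi
    by (subst complex_mod_cnj[symmetric]) simp
  have "(\<Sum>q\<in>{1..Q}. \<Sum>chi\<in>X q. (cmod (\<Sum>n\<in>{1..N}. b n * chi n))\<^sup>2)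
    = (\<Sum>q\<in>{1..Q}. \<Sum>chi\<in>X q. 1 * (cmod (\<Sum>n\<in>{1..N}. cnj (b n) * cnj (chi n)))\<^sup>2)"
    by (simp only: norm mult_1)
  also have "\<dots> \<le> (\<Sum>q\<in>{1..Q}. \<Sum>chi\<in>X q. real q / real (totient q) *
      (\<Sum>r\<in>{1}. 1 / real (totient r)) * (cmod (\<Sum>n\<in>{1..N}. cnj (b n) * cnj (chi n)))\<^sup>2)"
    by (intro sum_mono mult_right_mono) (auto simp: totient_le)
  also have "\<dots> \<le> 12 * real N * (\<Sum>n\<in>{1..N}. (cmod (cnj (b n)))\<^sup>2)"
    by (rule large_sieve_multiplicative[where X=X, OF Q X]) auto
  finally show ?thesis by simp
qed

section \<open>Splitting the primes at the square root of \<open>N\<close>\<close>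

theorem theorem2:
  fixes eps :: real
  assumes "eps > 0"
  shows "\<exists>C. \<forall>(N::nat) (Q::nat) (R::nat) (a :: nat \<Rightarrow> complex).
           real N > real Q powr (2 + eps) \<and> 2 \<le> R \<and> real R \<le> sqrt (real N) \<longrightarrow>
           (\<Sum>q\<in>{1..Q}. \<Sum>chi\<in>{chi. primitive_char q chi}.
              (cmod (\<Sum>p\<in>{p. prime p \<and> p \<le> N}. a p * chi p))\<^sup>2)
           \<le> C * (real N / ln (real N)) * (\<Sum>p\<in>{p. prime p \<and> p \<le> N}. (cmod (a p))\<^sup>2)"
proof -
  \<comment> \<open>As \<open>q <= Q < N powr (1 / (2 + eps))\<close>, the quotient
    \<open>sqrt N / q\<close> exceeds \<open>N powr \<delta>\<close>.\<close>
  define \<delta> where "\<delta> = 1 / 2 - 1 / (2 + eps)"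
  \<comment> \<open>With this choice \<open>N powr (1 - \<gamma>)\<close> dominates both
    \<open>sqrt N\<close> and \<open>N powr (1 - 2 * \<delta>)\<close>, the latter bounding
    \<open>Q^2\<close>.\<close>
  define \<gamma> where "\<gamma> = min (1 / 2) (2 * \<delta>)"
  have \<delta>: "\<delta> > 0" using assms by (simp add: \<delta>_def field_simps)
  then have \<gamma>: "\<gamma> > 0" "\<gamma> \<le> 1 / 2" "\<gamma> \<le> 2 * \<delta>" by (simp_all add: \<gamma>_def)
  show ?thesis
  \<comment> \<open>The sieve constant 12 doubles when the square of a sum is split in two;
    \<open>\<delta>\<close> belongs to the large primes and \<open>\<gamma>\<close> to the small
    ones.\<close>
  proof (intro exI[of _ "24 / \<delta> + 24 / \<gamma>"] allI impI)
    fix N Q R :: nat and a :: "nat \<Rightarrow> complex"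
    assume asm: "real N > real Q powr (2 + eps) \<and> 2 \<le> R \<and> real R \<le> sqrt (real N)"
    define PN where "PN = {p. prime p \<and> p \<le> N}"
    define B where "B = (\<Sum>p\<in>PN. (cmod (a p))\<^sup>2)"
    have B0: "B \<ge> 0" by (simp add: B_def sum_nonneg)
    have "2 \<le> sqrt (real N)" using asm by linarith
    then have "2\<^sup>2 \<le> (sqrt (real N))\<^sup>2" by (intro power_mono) auto
    then have N4: "real N \<ge> 4" by simp
    then have lnN: "ln (real N) > 0" by simp
    \<comment> \<open>A sum over an infinite set is 0, so finiteness of the set of characters need not be proved.\<close>
    define X where "X q = (if finite {chi. primitive_char q chi} then {chi. primitive_char q chi} else {})" for q
    have X: "\<And>q. finite (X q)" "\<And>q chi. chi \<in> X q \<Longrightarrow> primitive_char q chi"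
      by (auto simp: X_def split: if_splits)
    define b where "b n = (if prime n then a n else 0)" for n
    define K where "K = nat \<lfloor>sqrt (real N)\<rfloor>"
    have KN: "real K \<le> sqrt (real N)" "sqrt (real N) < real K + 1"
      unfolding K_def by (simp_all add: of_nat_nat)
    have "(real K)\<^sup>2 \<le> (sqrt (real N))\<^sup>2" using KN by (intro power_mono) auto
    then have "real (K\<^sup>2) \<le> real N" by simp
    then have K2: "K\<^sup>2 \<le> N" by (simp only: of_nat_le_iff)
    have "K \<le> N" using K2 le_square[of K] unfolding power2_eq_square by (rule order_trans[rotated])
    \<comment> \<open>\<open>bL\<close> lives on primes exceeding every modulus up to
      \<open>K\<close>, \<open>bS\<close> on the remaining primes.\<close>
    define bL where "bL n = (if K < n \<and> n \<le> N then b n else 0)" for n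
    define bS where "bS n = (if n \<le> K then b n else 0)" for n
    define T where "T f = (\<Sum>q\<in>{1..Q}. \<Sum>chi\<in>X q. (cmod (\<Sum>n\<in>{1..N}. f n * chi n))\<^sup>2)" for f
    have PN: "PN = {n\<in>{1..N}. prime n}" using prime_gt_0_nat by (auto simp: PN_def Suc_le_eq)
    have "(\<Sum>q\<in>{1..Q}. \<Sum>chi\<in>{chi. primitive_char q chi}. (cmod (\<Sum>p\<in>PN. a p * chi p))\<^sup>2) = T b"
      unfolding T_def
    proof (rule sum.cong[OF refl])
      fix q
      have "(\<Sum>p\<in>PN. a p * chi p) = (\<Sum>n\<in>{1..N}. b n * chi n)" for chi
        unfolding PN by (intro sum.mono_neutral_cong_left) (auto simp: b_def)
      then show "(\<Sum>chi\<in>{chi. primitive_char q chi}. (cmod (\<Sum>p\<in>PN. a p * chi p))\<^sup>2)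
         = (\<Sum>chi\<in>X q. (cmod (\<Sum>n\<in>{1..N}. b n * chi n))\<^sup>2)"
        by (auto simp: X_def)
    qed
    moreover have "T b \<le> 2 * T bL + 2 * T bS"
    proof -
      have "(cmod (\<Sum>n\<in>{1..N}. b n * chi n))\<^sup>2
        \<le> 2 * (cmod (\<Sum>n\<in>{1..N}. bL n * chi n))\<^sup>2 + 2 * (cmod (\<Sum>n\<in>{1..N}. bS n * chi n))\<^sup>2" for chi
      proof -
        have "(\<Sum>n\<in>{1..N}. b n * chi n) = (\<Sum>n\<in>{1..N}. bL n * chi n) + (\<Sum>n\<in>{1..N}. bS n * chi n)"
          unfolding sum.distrib[symmetric] by (intro sum.cong refl) (auto simp: bL_def bS_def)
        then have "cmod (\<Sum>n\<in>{1..N}. b n * chi n) \<le> cmod (\<Sum>n\<in>{1..N}. bL n * chi n) + cmod (\<Sum>n\<in>{1..N}. bS n * chi n)"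
          by (simp add: norm_triangle_ineq)
        then have "(cmod (\<Sum>n\<in>{1..N}. b n * chi n))\<^sup>2 \<le> (cmod (\<Sum>n\<in>{1..N}. bL n * chi n) + cmod (\<Sum>n\<in>{1..N}. bS n * chi n))\<^sup>2"
          by (intro power_mono) auto
        also have "\<dots> \<le> 2 * (cmod (\<Sum>n\<in>{1..N}. bL n * chi n))\<^sup>2 + 2 * (cmod (\<Sum>n\<in>{1..N}. bS n * chi n))\<^sup>2"
          using sum_squares_bound[of "cmod (\<Sum>n\<in>{1..N}. bL n * chi n)" "cmod (\<Sum>n\<in>{1..N}. bS n * chi n)"]
          by (simp add: power2_sum)
        finally show ?thesis .
      qed
      then show ?thesis unfolding T_def sum_distrib_left sum.distrib[symmetric] by (intro sum_mono)
    qed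
    moreover have "T bL \<le> 12 / \<delta> * (real N / ln (real N)) * B \<and> T bS \<le> 12 / \<gamma> * (real N / ln (real N)) * B"
    \<comment> \<open>The logarithm of \<open>Q\<close> is used below; for \<open>Q = 0\<close> the
      sums over \<open>q\<close> are empty.\<close>
    proof (cases "Q = 0")
      case True
      then show ?thesis using B0 \<delta> \<gamma> lnN by (simp add: T_def)
    next
      case False
      then have Q1: "real Q \<ge> 1" by simp
      have "ln (real Q powr (2 + eps)) < ln (real N)"
        using asm Q1 N4 by (intro ln_less_cancel_iff[THEN iffD2]) auto
      then have "(2 + eps) * ln (real Q) < ln (real N)" using Q1 by (simp add: ln_powr)
      then have lnQ: "ln (real Q) < ln (real N) / (2 + eps)" using assms by (simp add: field_simps)
      have normB: "(\<Sum>n\<in>{1..M}. (cmod (f n))\<^sup>2) \<le> B"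
        if f: "\<And>n. f n = b n \<or> f n = 0" "\<And>n. n > N \<Longrightarrow> f n = 0" for f M
      proof -
        have f': "n \<in> PN \<and> f n = a n" if "f n \<noteq> 0" for n
          using f(1)[of n] f(2)[of n] that by (cases "n > N") (auto simp: b_def PN_def split: if_splits)
        have "(\<Sum>n\<in>{1..M}. (cmod (f n))\<^sup>2) = (\<Sum>n\<in>{n\<in>{1..M}. f n \<noteq> 0}. (cmod (a n))\<^sup>2)"
          by (intro sum.mono_neutral_cong_right) (auto dest: f')
        also have "\<dots> \<le> B" unfolding B_def
          by (rule sum_mono2) (auto simp: PN dest: f'[unfolded PN])
        finally show ?thesis .
      qed
      have "\<delta> * ln (real N) * T bL \<le> 12 * real N * (\<Sum>n\<in>{1..N}. (cmod (bL n))\<^sup>2)"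
        unfolding T_def
      proof (rule large_sieve_rough[OF X K2])
        fix q assume q: "q \<in> {1..Q}"
        \<comment> \<open>Division with remainder gives
          \<open>sqrt N < K + 1 <= (K div q + 1) * q\<close>. Hence \<open>K div q + 1\<close>
          exceeds \<open>sqrt N / Q\<close>, and its logarithm is at least
          \<open>\<delta> * ln N\<close>.\<close>
        have "K mod q < q" using q by simp
        then have "K + 1 \<le> K div q * q + q" using div_mult_mod_eq[of K q] by linarith
        then have "K + 1 \<le> (K div q + 1) * q" by simp
        then have "real (K + 1) \<le> real ((K div q + 1) * q)" by (simp only: of_nat_le_iff)
        then have "sqrt (real N) < (real (K div q) + 1) * real q" using KN(2) by (simp add: algebra_simps)
        also have "\<dots> \<le> (real (K div q) + 1) * real Q" using q by (intro mult_left_mono) auto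
        finally have "ln (sqrt (real N)) \<le> ln ((real (K div q) + 1) * real Q)"
          using N4 by (intro ln_mono) auto
        also have "\<dots> = ln (real (K div q) + 1) + ln (real Q)"
          using Q1 by (subst ln_mult) auto
        finally have "ln (real N) / 2 \<le> ln (real (K div q) + 1) + ln (real Q)"
          using N4 by (simp add: ln_sqrt)
        then have "\<delta> * ln (real N) \<le> ln (real (K div q) + 1)"
          using lnQ by (simp add: \<delta>_def left_diff_distrib)
        also have "\<dots> \<le> harm (K div q)" by (rule ln_le_harm)
        finally show "\<delta> * ln (real N) \<le> harm (K div q)" .
      next
        fix n k assume "bL n \<noteq> 0" "k \<in> {1..K}"
        then have "prime n" "k < n" "0 < k" by (auto simp: bL_def b_def split: if_splits)
        then show "coprime n k" by (intro prime_imp_coprime) (auto dest: dvd_imp_le)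
      qed
      also have "\<dots> \<le> 12 * real N * B"
        by (intro mult_left_mono normB) (auto simp: bL_def)
      finally have 1: "T bL \<le> 12 / \<delta> * (real N / ln (real N)) * B"
        using \<delta> lnN by (simp add: field_simps)
      \<comment> \<open>The classical sieve needs a length covering the support of \<open>bS\<close>
        and at least \<open>Q^2\<close>.\<close>
      define M where "M = max K (Q\<^sup>2)"
      have QM: "Q\<^sup>2 \<le> M" by (simp add: M_def)
      have M: "real M \<le> real N powr (1 - \<gamma>)"
      proof -
        have "real K \<le> real N powr (1 / 2)" using KN(1) N4 by (simp add: powr_half_sqrt)
        also have "\<dots> \<le> real N powr (1 - \<gamma>)" using N4 \<gamma> by (intro powr_mono) auto
        finally have "real K \<le> \<dots>" .
        moreover have "real (Q\<^sup>2) \<le> real N powr (1 - \<gamma>)"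
        proof -
          have "real (Q\<^sup>2) = exp (2 * ln (real Q))"
            using Q1 by (simp add: exp_double)
          also have "\<dots> \<le> exp ((1 - \<gamma>) * ln (real N))"
          proof -
            have "2 * ln (real Q) \<le> (1 - 2 * \<delta>) * ln (real N)"
              using lnQ by (simp add: \<delta>_def algebra_simps)
            also have "\<dots> \<le> (1 - \<gamma>) * ln (real N)"
              using \<gamma> lnN by (intro mult_right_mono) auto
            finally show ?thesis by simp
          qed
          also have "\<dots> = real N powr (1 - \<gamma>)" using N4 by (simp add: powr_def)
          finally show ?thesis .
        qed
        ultimately show ?thesis by (simp add: M_def max_def)
      qed
      \<comment> \<open>The power saving absorbs the logarithm through
        \<open>ln N <= N powr \<gamma> / \<gamma>\<close>.\<close>
      have "real M * ln (real N) \<le> real N powr (1 - \<gamma>) * (real N powr \<gamma> / \<gamma>)"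
        using N4 \<gamma> lnN M by (intro mult_mono ln_powr_bound) auto
      also have "\<dots> = real N / \<gamma>"
        using N4 by (simp add: powr_add[symmetric])
      finally have M': "real M \<le> real N / ln (real N) / \<gamma>"
        using lnN \<gamma> by (simp add: field_simps)
      have "T bS = (\<Sum>q\<in>{1..Q}. \<Sum>chi\<in>X q. (cmod (\<Sum>n\<in>{1..M}. bS n * chi n))\<^sup>2)"
      proof -
        \<comment> \<open>Since \<open>bS\<close> vanishes beyond \<open>K\<close>, the length
          \<open>N\<close> may be replaced by \<open>M\<close>, whichever of the two is
          larger.\<close>
        have *: "(\<Sum>n\<in>{1..J}. bS n * chi n) = (\<Sum>n\<in>{1..K}. bS n * chi n)" if "K \<le> J" for J chi
          using that by (intro sum.mono_neutral_right) (auto simp: bS_def)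
        have "(\<Sum>n\<in>{1..N}. bS n * chi n) = (\<Sum>n\<in>{1..M}. bS n * chi n)" for chi
          using *[OF \<open>K \<le> N\<close>] *[of M] by (simp only: M_def max.cobounded1)
        then show ?thesis by (simp only: T_def)
      qed
      also have "\<dots> \<le> 12 * real M * (\<Sum>n\<in>{1..M}. (cmod (bS n))\<^sup>2)"
        using large_sieve_classical[where X=X, OF X QM] .
      also have "\<dots> \<le> 12 * (real N / ln (real N) / \<gamma>) * B"
      proof (intro mult_mono normB M')
        show "bS n = 0" if "n > N" for n using that \<open>K \<le> N\<close> by (simp add: bS_def)
      qed (use lnN \<gamma> in \<open>auto simp: bS_def sum_nonneg\<close>)
      finally have "T bS \<le> 12 / \<gamma> * (real N / ln (real N)) * B" by (simp add: mult_ac)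
      with 1 show ?thesis by blast
    qed
    moreover have "(24 / \<delta> + 24 / \<gamma>) * (real N / ln (real N)) * B
      = 2 * (12 / \<delta> * (real N / ln (real N)) * B) + 2 * (12 / \<gamma> * (real N / ln (real N)) * B)"
      by (simp only: distrib_right)
    ultimately have "(\<Sum>q\<in>{1..Q}. \<Sum>chi\<in>{chi. primitive_char q chi}. (cmod (\<Sum>p\<in>PN. a p * chi p))\<^sup>2)
      \<le> (24 / \<delta> + 24 / \<gamma>) * (real N / ln (real N)) * B"
      by linarith
    then show "(\<Sum>q\<in>{1..Q}. \<Sum>chi\<in>{chi. primitive_char q chi}.
          (cmod (\<Sum>p\<in>{p. prime p \<and> p \<le> N}. a p * chi p))\<^sup>2)
        \<le> (24 / \<delta> + 24 / \<gamma>) * (real N / ln (real N)) * (\<Sum>p\<in>{p. prime p \<and> p \<le> N}. (cmod (a p))\<^sup>2)"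
      unfolding PN_def B_def .
  qed
qed

end
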